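(* The set $\mathrm{Lip}_1(S^1)$ of $1$-Lipschitz functions agrees with the set of (complex-valued) Lipschitz functions on $S^1$ with respect to the standard arc length metric on the unit circle. Moreover, for every $f\in\mathrm{Lip}_1(S^1)$ the operator norm $\|\mathrm{d}_1(f)\|_\infty$ agrees with the Lipschitz constant of $f$ with respect to the arc length metric.
   Context: $\ell^2(\mathbb{Z})$ has standard orthonormal basis $(e_j)_{j\in\mathbb{Z}}$, inner products are linear in the second variable, and $\|\cdot\|_\infty$ denotes the operator norm. For a bounded operator $T$ on $\ell^2(\mathbb{Z})$ write $T_{jk} := \langle e_j, Te_k\rangle$. Let $U$ be the bilateral shift, $U e_j = e_{j+1}$. The $C^*$-algebra $C(S^1)$ of continuous complex functions on the unit circle $S^1\subseteq\mathbb{C}$ is identified with $C^*(U)\subseteq \mathbb{B}(\ell^2(\mathbb{Z}))$ via $z\mapsto U$, where $z:S^1\to\mathbb{C}$ is the inclusion. $\mathrm{Lip}_1(\ell^2(\mathbb{Z}))$ is the set of bounded operators $T$ on $\ell^2(\mathbb{Z})$ such that the infinite matrix $(i(j-k) T_{jk})_{j,k\in\mathbb{Z}}$ is the matrix of a bounded operator; this bounded operator is denoted $\mathrm{d}_1(T)$. The set of $1$-Lipschitz functions is $\mathrm{Lip}_1(S^1) := C(S^1)\cap \mathrm{Lip}_1(\ell^2(\mathbb{Z}))$. (Here the "$1$" refers to the parameter value $q=1$, not to a bound on the Lipschitz constant.) *)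

theory Defs
  imports "HOL-Analysis.Analysis"
begin

section \<open>The Hilbert space of square-summable bilateral sequences\<close>

typedef ell2 = "{x :: int \<Rightarrow> complex. (\<lambda>j. (cmod (x j))\<^sup>2) summable_on UNIV}"
  morphisms coord Abs_ell2
  by (rule exI[of _ "\<lambda>_. 0"]) simp

setup_lifting type_definition_ell2

lemma coord_summable: "(\<lambda>j. (cmod (coord x j))\<^sup>2) summable_on UNIV"
  using coord[of x] by simp

lemma ell2_eqI: "(\<And>j. coord x j = coord y j) \<Longrightarrow> x = y"
  by (metis coord_inject ext)

lemma ell2_eq_iff: "x = y \<longleftrightarrow> (\<forall>j. coord x j = coord y j)"
  using ell2_eqI by auto

lemma sq_summable_add:
  fixes x y :: "int \<Rightarrow> complex"
  assumes "(\<lambda>j. (cmod (x j))\<^sup>2) summable_on UNIV" "(\<lambda>j. (cmod (y j))\<^sup>2) summable_on UNIV"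
  shows "(\<lambda>j. (cmod (x j + y j))\<^sup>2) summable_on UNIV"
proof (rule summable_on_comparison_test)
  show "(\<lambda>j. 2 * ((cmod (x j))\<^sup>2 + (cmod (y j))\<^sup>2)) summable_on UNIV"
    by (intro summable_on_cmult_right summable_on_add assms)
  fix j
  have "(cmod (x j + y j))\<^sup>2 \<le> (cmod (x j) + cmod (y j))\<^sup>2"
    by (intro power_mono norm_triangle_ineq) auto
  also have "\<dots> \<le> 2 * ((cmod (x j))\<^sup>2 + (cmod (y j))\<^sup>2)"
    using sum_squares_bound[of "cmod (x j)" "cmod (y j)"] by (simp add: power2_sum)
  finally show "(cmod (x j + y j))\<^sup>2 \<le> 2 * ((cmod (x j))\<^sup>2 + (cmod (y j))\<^sup>2)" .
qed auto

lemma sq_summable_cmult: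
  fixes x :: "int \<Rightarrow> complex"
  assumes "(\<lambda>j. (cmod (x j))\<^sup>2) summable_on UNIV"
  shows "(\<lambda>j. (cmod (c * x j))\<^sup>2) summable_on UNIV"
  using summable_on_cmult_right[OF assms, of "(cmod c)\<^sup>2"]
  by (simp add: norm_mult power_mult_distrib)

lemma coord_mult_summable: "(\<lambda>j. cnj (coord x j) * coord y j) summable_on UNIV"
proof -
  have "(\<lambda>j. norm (cnj (coord x j) * coord y j)) summable_on UNIV"
  proof (rule summable_on_comparison_test)
    show "(\<lambda>j. (cmod (coord x j))\<^sup>2 + (cmod (coord y j))\<^sup>2) summable_on UNIV"
      by (intro summable_on_add coord_summable)
    show "norm (cnj (coord x j) * coord y j) \<le> (cmod (coord x j))\<^sup>2 + (cmod (coord y j))\<^sup>2" for j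
      using sum_squares_bound[of "cmod (coord x j)" "cmod (coord y j)"]
        mult_nonneg_nonneg[OF norm_ge_zero[of "coord x j"] norm_ge_zero[of "coord y j"]]
      unfolding norm_mult complex_mod_cnj by linarith
  qed auto
  then show ?thesis
    by (rule abs_summable_summable)
qed

definition cinner :: "ell2 \<Rightarrow> ell2 \<Rightarrow> complex"
  where "cinner x y = (\<Sum>\<^sub>\<infinity>j. cnj (coord x j) * coord y j)"

lift_definition cscale :: "complex \<Rightarrow> ell2 \<Rightarrow> ell2"
  is "\<lambda>c x j. c * x j"
  by (simp add: sq_summable_cmult)

instantiation ell2 :: real_inner
begin

lift_definition zero_ell2 :: ell2 is "\<lambda>_. 0" by simp

lift_definition plus_ell2 :: "ell2 \<Rightarrow> ell2 \<Rightarrow> ell2" is "\<lambda>x y j. x j + y j"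
  by (simp add: sq_summable_add)

lift_definition uminus_ell2 :: "ell2 \<Rightarrow> ell2" is "\<lambda>x j. - x j" by simp

definition minus_ell2 :: "ell2 \<Rightarrow> ell2 \<Rightarrow> ell2" where "minus_ell2 x y = x + - y"

definition scaleR_ell2 :: "real \<Rightarrow> ell2 \<Rightarrow> ell2" where "scaleR_ell2 r x = cscale (of_real r) x"

definition inner_ell2 :: "ell2 \<Rightarrow> ell2 \<Rightarrow> real" where "inner_ell2 x y = Re (cinner x y)"

definition norm_ell2 :: "ell2 \<Rightarrow> real" where "norm_ell2 x = sqrt (inner x x)"

definition sgn_ell2 :: "ell2 \<Rightarrow> ell2" where "sgn_ell2 x = inverse (norm x) *\<^sub>R x"

definition dist_ell2 :: "ell2 \<Rightarrow> ell2 \<Rightarrow> real" where "dist_ell2 x y = norm (x - y)"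

definition uniformity_ell2 :: "(ell2 \<times> ell2) filter"
  where "uniformity_ell2 = (INF e\<in>{0<..}. principal {(x, y). dist x y < e})"

definition open_ell2 :: "ell2 set \<Rightarrow> bool"
  where "open_ell2 S \<longleftrightarrow> (\<forall>x\<in>S. \<forall>\<^sub>F (x', y) in uniformity. x' = x \<longrightarrow> y \<in> S)"

instance
proof
  have minus_coord: "coord (x - y) j = coord x j - coord y j" for x y j
    by (simp add: minus_ell2_def plus_ell2.rep_eq uminus_ell2.rep_eq)
  have summ: "(\<lambda>j. cnj (coord x j) * coord y j) summable_on UNIV" for x y
    by (rule coord_mult_summable)
  have self: "cinner x x = of_real (\<Sum>\<^sub>\<infinity>j. (cmod (coord x j))\<^sup>2)" for x
  proof -
    have "((\<lambda>j. (cmod (coord x j))\<^sup>2) has_sum (\<Sum>\<^sub>\<infinity>j. (cmod (coord x j))\<^sup>2)) UNIV"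
      using coord_summable by simp
    then have "((\<lambda>j. complex_of_real ((cmod (coord x j))\<^sup>2)) has_sum of_real (\<Sum>\<^sub>\<infinity>j. (cmod (coord x j))\<^sup>2)) UNIV"
      by (rule has_sum_of_real)
    then show ?thesis
      unfolding cinner_def
      by (metis (no_types, lifting) complex_norm_square infsumI has_sum_cong mult.commute)
  qed
  fix x y z :: ell2 and r s :: real
  show "x + y + z = x + (y + z)" "x + y = y + x" "0 + x = x" "- x + x = 0"
    "r *\<^sub>R (x + y) = r *\<^sub>R x + r *\<^sub>R y" "(r + s) *\<^sub>R x = r *\<^sub>R x + s *\<^sub>R x"
    "r *\<^sub>R s *\<^sub>R x = (r * s) *\<^sub>R x" "1 *\<^sub>R x = x"
    by (auto simp: ell2_eq_iff scaleR_ell2_def cscale.rep_eq plus_ell2.rep_eq uminus_ell2.rep_eq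
        zero_ell2.rep_eq algebra_simps)
  show "x - y = x + - y" by (rule minus_ell2_def)
  show "sgn x = inverse (norm x) *\<^sub>R x" by (rule sgn_ell2_def)
  show "dist x y = norm (x - y)" by (rule dist_ell2_def)
  show "uniformity = (INF e\<in>{0<..}. principal {(x, y::ell2). dist x y < e})"
    by (rule uniformity_ell2_def)
  show "open S \<longleftrightarrow> (\<forall>x\<in>S. \<forall>\<^sub>F (x', y) in uniformity. x' = x \<longrightarrow> y \<in> S)" for S :: "ell2 set"
    by (rule open_ell2_def)
  show "norm x = sqrt (inner x x)" by (rule norm_ell2_def)
  have "cinner y x = cnj (cinner x y)"
    unfolding cinner_def infsum_cnj[symmetric] by (simp add: mult.commute)
  then show "inner x y = inner y x"
    by (simp add: inner_ell2_def)
  have "cinner (x + y) z = cinner x z + cinner y z"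
    unfolding cinner_def plus_ell2.rep_eq
    by (simp add: distrib_right infsum_add summ)
  then show "inner (x + y) z = inner x z + inner y z"
    by (simp add: inner_ell2_def)
  have "cinner (r *\<^sub>R x) y = of_real r * cinner x y"
    unfolding cinner_def scaleR_ell2_def cscale.rep_eq
    by (simp add: mult.assoc infsum_cmult_right')
  then show "inner (r *\<^sub>R x) y = r * inner x y"
    by (simp add: inner_ell2_def)
  show "0 \<le> inner x x"
    by (simp add: inner_ell2_def self infsum_nonneg)
  show "inner x x = 0 \<longleftrightarrow> x = 0"
  proof
    assume "inner x x = 0"
    then have "(\<Sum>\<^sub>\<infinity>j. (cmod (coord x j))\<^sup>2) = 0"
      by (simp add: inner_ell2_def self)
    then have "(cmod (coord x j))\<^sup>2 = 0" for j
      by (intro nonneg_infsum_le_0D[where A = UNIV and f = "\<lambda>j. (cmod (coord x j))\<^sup>2"])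
        (auto simp: coord_summable)
    then show "x = 0"
      by (simp add: ell2_eq_iff zero_ell2.rep_eq)
  qed (simp add: inner_ell2_def self zero_ell2.rep_eq)
qed

end

lemma coord_simps [simp]:
  "coord 0 j = 0" "coord (x + y) j = coord x j + coord y j" "coord (- x) j = - coord x j"
  "coord (x - y) j = coord x j - coord y j" "coord (cscale c x) j = c * coord x j"
  "coord (r *\<^sub>R x) j = of_real r * coord x j"
  by (simp_all only: zero_ell2.rep_eq plus_ell2.rep_eq uminus_ell2.rep_eq minus_ell2_def
      cscale.rep_eq scaleR_ell2_def diff_conv_add_uminus)

lemma norm_ell2_has_sum: "((\<lambda>j. (cmod (coord x j))\<^sup>2) has_sum (norm x)\<^sup>2) UNIV"
proof -
  have sq: "Re (cnj c * c) = (cmod c)\<^sup>2" for c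
    unfolding cmod_power2 by (simp add: power2_eq_square)
  have nx: "Re (cinner x x) = (norm x)\<^sup>2"
    by (simp only: power2_norm_eq_inner inner_ell2_def)
  have "((\<lambda>j. cnj (coord x j) * coord x j) has_sum cinner x x) UNIV"
    unfolding cinner_def by (rule has_sum_infsum[OF coord_mult_summable])
  from has_sum_Re[OF this] show ?thesis
    unfolding sq nx .
qed

lemma norm_cscale [simp]: "norm (cscale c x) = cmod c * norm x"
proof -
  have "((\<lambda>j. (cmod c)\<^sup>2 * (cmod (coord x j))\<^sup>2) has_sum (cmod c)\<^sup>2 * (norm x)\<^sup>2) UNIV"
    by (intro has_sum_cmult_right norm_ell2_has_sum)
  then have "((\<lambda>j. (cmod (coord (cscale c x) j))\<^sup>2) has_sum (cmod c * norm x)\<^sup>2) UNIV"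
    by (simp add: norm_mult power_mult_distrib)
  then have "(norm (cscale c x))\<^sup>2 = (cmod c * norm x)\<^sup>2"
    by (rule has_sum_unique[OF norm_ell2_has_sum])
  then show ?thesis
    by (rule power2_eq_imp_eq) simp_all
qed

lemma cmod_coord_le: "cmod (coord x j) \<le> norm x"
proof -
  have "(\<Sum>j\<in>{j}. (cmod (coord x j))\<^sup>2) \<le> (norm x)\<^sup>2"
    by (rule finite_sum_le_has_sum[OF norm_ell2_has_sum]) simp_all
  then have "(cmod (coord x j))\<^sup>2 \<le> (norm x)\<^sup>2"
    by simp
  then show ?thesis
    by (rule power2_le_imp_le) simp
qed

lemma coord_sum [simp]: "coord (sum f A) j = (\<Sum>a\<in>A. coord (f a) j)"
  by (induction A rule: infinite_finite_induct) auto

instance ell2 :: banach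
proof
  fix X :: "nat \<Rightarrow> ell2"
  assume X: "Cauchy X"
  define l where "l j = lim (\<lambda>n. coord (X n) j)" for j
  have l: "(\<lambda>n. coord (X n) j) \<longlonglongrightarrow> l j" for j
  proof -
    have "Cauchy (\<lambda>n. coord (X n) j)"
    proof (rule CauchyI)
      fix e :: real assume "0 < e"
      with X obtain M where M: "\<And>m n. m \<ge> M \<Longrightarrow> n \<ge> M \<Longrightarrow> norm (X m - X n) < e"
        by (meson CauchyD)
      have "norm (coord (X m) j - coord (X n) j) < e" if "m \<ge> M" "n \<ge> M" for m n
        using le_less_trans[OF cmod_coord_le[of "X m - X n" j] M[OF that]] by simp
      then show "\<exists>M. \<forall>m\<ge>M. \<forall>n\<ge>M. norm (coord (X m) j - coord (X n) j) < e"
        by blast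
    qed
    then show ?thesis
      unfolding l_def using Cauchy_convergent convergent_LIMSEQ_iff by blast
  qed
  have fin: "(\<Sum>j\<in>F. (cmod (coord (X n) j - l j))\<^sup>2) \<le> e\<^sup>2"
    if "finite F" "e > 0" "\<And>m. m \<ge> M \<Longrightarrow> norm (X n - X m) < e" for F e n M
  proof (rule LIMSEQ_le_const2)
    show "(\<lambda>m. \<Sum>j\<in>F. (cmod (coord (X n) j - coord (X m) j))\<^sup>2) \<longlonglongrightarrow> (\<Sum>j\<in>F. (cmod (coord (X n) j - l j))\<^sup>2)"
      by (intro tendsto_intros l)
    have "(\<Sum>j\<in>F. (cmod (coord (X n) j - coord (X m) j))\<^sup>2) \<le> e\<^sup>2" if "m \<ge> M" for m
    proof -
      have "(\<Sum>j\<in>F. (cmod (coord (X n - X m) j))\<^sup>2) \<le> (norm (X n - X m))\<^sup>2"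
        by (rule finite_sum_le_has_sum[OF norm_ell2_has_sum]) (auto simp: \<open>finite F\<close>)
      also have "\<dots> \<le> e\<^sup>2"
        using \<open>\<And>m. m \<ge> M \<Longrightarrow> norm (X n - X m) < e\<close>[OF that] by (intro power_mono) auto
      finally show ?thesis by simp
    qed
    then show "\<exists>N. \<forall>m\<ge>N. (\<Sum>j\<in>F. (cmod (coord (X n) j - coord (X m) j))\<^sup>2) \<le> e\<^sup>2"
      by blast
  qed
  have summ: "(\<lambda>j. (cmod (coord (X n) j - l j))\<^sup>2) summable_on UNIV"
    if "e > 0" "\<And>m. m \<ge> M \<Longrightarrow> norm (X n - X m) < e" for e n M
  proof (rule nonneg_bdd_above_summable_on)
    show "bdd_above (sum (\<lambda>j. (cmod (coord (X n) j - l j))\<^sup>2) ` {F. F \<subseteq> UNIV \<and> finite F})"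
      by (rule bdd_aboveI2[where M = "e\<^sup>2"]) (use fin[OF _ that] in blast)
  qed simp
  obtain M where M: "\<And>m n. m \<ge> M \<Longrightarrow> n \<ge> M \<Longrightarrow> norm (X m - X n) < 1"
    using X by (meson CauchyD zero_less_one)
  have "(\<lambda>j. (cmod (coord (X M) j + (- 1) * (coord (X M) j - l j)))\<^sup>2) summable_on UNIV"
    by (rule sq_summable_add[OF coord_summable sq_summable_cmult[OF summ[of 1 M M]]]) (auto intro: M)
  then have "(\<lambda>j. (cmod (l j))\<^sup>2) summable_on UNIV"
    by simp
  then obtain x where x: "\<And>j. coord x j = l j"
    by (metis (mono_tags) Abs_ell2_inverse mem_Collect_eq)
  have "X \<longlonglongrightarrow> x"
  proof (rule LIMSEQ_I)
    fix e :: real assume "0 < e"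
    then obtain N where N: "\<And>m n. m \<ge> N \<Longrightarrow> n \<ge> N \<Longrightarrow> norm (X m - X n) < e / 2"
      using X by (meson CauchyD half_gt_zero)
    have "norm (X n - x) < e" if "n \<ge> N" for n
    proof -
      have "(norm (X n - x))\<^sup>2 \<le> (e / 2)\<^sup>2"
      proof (rule has_sum_le_finite_sums[OF norm_ell2_has_sum])
        fix F :: "int set" assume "finite F"
        then show "(\<Sum>j\<in>F. (cmod (coord (X n - x) j))\<^sup>2) \<le> (e / 2)\<^sup>2"
          unfolding coord_simps x using \<open>0 < e\<close> N[OF that] by (intro fin) auto
      qed
      then have "norm (X n - x) \<le> e / 2"
        by (rule power2_le_imp_le) (use \<open>0 < e\<close> in simp)
      with \<open>0 < e\<close> show ?thesis by simp
    qed
    then show "\<exists>N. \<forall>n\<ge>N. norm (X n - x) < e" by blast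
  qed
  then show "convergent X"
    by (auto simp: convergent_def)
qed

lemma cinner_add_left: "cinner (x + y) z = cinner x z + cinner y z"
  unfolding cinner_def by (simp add: distrib_right infsum_add coord_mult_summable)

lemma cinner_add_right: "cinner z (x + y) = cinner z x + cinner z y"
  unfolding cinner_def by (simp add: distrib_left infsum_add coord_mult_summable)

lemma cinner_cscale_left: "cinner (cscale c x) y = cnj c * cinner x y"
  unfolding cinner_def by (simp add: mult.assoc infsum_cmult_right')

lemma cinner_cscale_right: "cinner x (cscale c y) = c * cinner x y"
  unfolding cinner_def by (simp add: mult.left_commute infsum_cmult_right')

lemma cinner_commute: "cinner y x = cnj (cinner x y)"
  unfolding cinner_def infsum_cnj[symmetric] by (simp add: mult.commute)

lemma cinner_conv_inner: "cinner x y = Complex (inner x y) (- inner x (cscale \<i> y))"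
  by (simp add: inner_ell2_def cinner_cscale_right complex_eq_iff)

lemma cinner_self: "cinner x x = of_real ((norm x)\<^sup>2)"
proof (rule complex_eqI)
  show "Re (cinner x x) = Re (of_real ((norm x)\<^sup>2))"
    by (simp add: power2_norm_eq_inner inner_ell2_def)
  show "Im (cinner x x) = Im (of_real ((norm x)\<^sup>2))"
    using cinner_commute[of x x] by (simp add: complex_eq_iff)
qed

lemma cscale_add: "cscale c (x + y) = cscale c x + cscale c y"
  by (simp add: ell2_eq_iff distrib_left)

lemma bounded_linear_cscale: "bounded_linear (cscale c)"
  by (rule bounded_linear_intro[where K = "cmod c"]) (simp_all add: cscale_add ell2_eq_iff)

lemma tendsto_cinner:
  assumes "(f \<longlongrightarrow> x) F" "(g \<longlongrightarrow> y) F"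
  shows "((\<lambda>n. cinner (f n) (g n)) \<longlongrightarrow> cinner x y) F"
  unfolding cinner_conv_inner
  by (intro tendsto_intros assms bounded_linear.tendsto[OF bounded_linear_cscale])

lift_definition ebasis :: "int \<Rightarrow> ell2" is "\<lambda>k j. if j = k then 1 else 0"
proof -
  fix k :: int
  show "(\<lambda>j. (cmod (if j = k then 1 else 0))\<^sup>2) summable_on UNIV"
    by (rule summable_on_cong_neutral[THEN iffD1, OF _ _ _ summable_on_finite[of "{k}" "\<lambda>_. 1"]]) auto
qed

lemma coord_ebasis [simp]: "coord (ebasis k) j = (if j = k then 1 else 0)"
  by (simp add: ebasis.rep_eq)

lemma cinner_ebasis_left: "cinner (ebasis j) x = coord x j"
proof -
  have "((\<lambda>i. cnj (coord (ebasis j) i) * coord x i) has_sum coord x j) UNIV"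
    by (rule has_sum_cong_neutral[THEN iffD1, OF _ _ _ has_sum_finiteI[of "{j}" _ "coord x"]]) auto
  then show ?thesis
    unfolding cinner_def by (rule infsumI)
qed

lemma cinner_ebasis: "cinner (ebasis j) (ebasis k) = (if j = k then 1 else 0)"
  by (simp add: cinner_ebasis_left)

lemma ebasis_has_sum: "((\<lambda>k. cscale (coord x k) (ebasis k)) has_sum x) UNIV"
proof -
  let ?p = "\<lambda>F. \<Sum>k\<in>F. cscale (coord x k) (ebasis k)"
  have dist: "(norm (?p F - x))\<^sup>2 = (norm x)\<^sup>2 - (\<Sum>j\<in>F. (cmod (coord x j))\<^sup>2)" if "finite F" for F
  proof -
    have c: "coord (?p F) j = (if j \<in> F then coord x j else 0)" for j
    proof -
      have "coord (?p F) j = (\<Sum>k\<in>F. if k = j then coord x j else 0)"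
        unfolding coord_sum by (intro sum.cong) auto
      then show ?thesis
        using that by simp
    qed
    have "((\<lambda>j. (cmod (coord x j))\<^sup>2) has_sum ((norm x)\<^sup>2 - (\<Sum>j\<in>F. (cmod (coord x j))\<^sup>2))) (UNIV - F)"
      by (rule has_sum_Diff[OF norm_ell2_has_sum]) (use that in \<open>auto intro: has_sum_finiteI\<close>)
    then have "((\<lambda>j. (cmod (coord (?p F - x) j))\<^sup>2) has_sum ((norm x)\<^sup>2 - (\<Sum>j\<in>F. (cmod (coord x j))\<^sup>2))) UNIV"
      by (rule has_sum_cong_neutral[THEN iffD1, rotated -1]) (auto simp: c simp del: coord_sum)
    from has_sum_unique[OF norm_ell2_has_sum this] show ?thesis .
  qed
  have "((\<lambda>F. (norm x)\<^sup>2 - (\<Sum>j\<in>F. (cmod (coord x j))\<^sup>2)) \<longlongrightarrow> (norm x)\<^sup>2 - (norm x)\<^sup>2) (finite_subsets_at_top UNIV)"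
    using norm_ell2_has_sum[of x] unfolding has_sum_def by (intro tendsto_intros)
  then have "((\<lambda>F. (norm (?p F - x))\<^sup>2) \<longlongrightarrow> 0) (finite_subsets_at_top UNIV)"
    by (subst tendsto_cong[OF eventually_finite_subsets_at_top_weakI]) (use dist in auto)
  then have "((\<lambda>F. sqrt ((norm (?p F - x))\<^sup>2)) \<longlongrightarrow> sqrt 0) (finite_subsets_at_top UNIV)"
    by (rule tendsto_real_sqrt)
  then show ?thesis
    unfolding has_sum_def by (simp add: tendsto_norm_zero_iff LIM_zero_iff)
qed

section \<open>Bounded operators\<close>

text \<open>
  A blinfun is only real-linear, so the bounded operators of the complex Hilbert space are the
  complex-linear ones among them.  The norm of the type is the operator norm.
\<close>

type_synonym rop = "ell2 \<Rightarrow>\<^sub>L ell2"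

definition bounded_ops :: "rop set"
  where "bounded_ops = {T :: rop. \<forall>c x. T (cscale c x) = cscale c (T x)}"

definition cmul_op :: "complex \<Rightarrow> rop \<Rightarrow> rop"
  where "cmul_op c T = Blinfun (\<lambda>x. cscale c (T x))"

text \<open>Convention: \<open>is_adjoint S T\<close> says that \<open>S\<close> is the adjoint of \<open>T\<close>.\<close>

definition is_adjoint :: "rop \<Rightarrow> rop \<Rightarrow> bool"
  where "is_adjoint S T \<longleftrightarrow> (\<forall>x y. cinner (S x) y = cinner x (T y))"

definition entry :: "rop \<Rightarrow> int \<Rightarrow> int \<Rightarrow> complex"
  where "entry T j k = cinner (ebasis j) (T (ebasis k))"

lemma cmul_op_apply [simp]: "cmul_op c T x = cscale c (T x)"
  unfolding cmul_op_def
  by (simp add: bounded_linear_Blinfun_apply bounded_linear_compose[OF bounded_linear_cscale]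
      blinfun.bounded_linear_right)

lemma bounded_ops_eqI:
  assumes "S \<in> bounded_ops" "T \<in> bounded_ops" "\<And>j k. entry S j k = entry T j k"
  shows "S = T"
proof (rule blinfun_eqI)
  fix x
  have eq: "S (ebasis k) = T (ebasis k)" for k
    using assms(3)[of _ k] by (simp add: entry_def cinner_ebasis_left ell2_eq_iff)
  have "((\<lambda>k. A (cscale (coord x k) (ebasis k))) has_sum A x) UNIV" for A :: rop
    by (rule has_sum_bounded_linear[OF blinfun.bounded_linear_right ebasis_has_sum])
  from this[of S] this[of T] show "S x = T x"
    using assms(1,2) has_sum_unique by (simp add: bounded_ops_def eq) blast
qed

definition Lip1_op :: "rop set"
  where "Lip1_op = {T \<in> bounded_ops. \<exists>S\<in>bounded_ops. \<forall>j k. entry S j k = \<i> * of_int (j - k) * entry T j k}"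

text \<open>Uniqueness of the operator is \<open>bounded_ops_eqI\<close>; off \<open>Lip1_op\<close> the value is arbitrary.\<close>

definition d1_op :: "rop \<Rightarrow> rop"
  where "d1_op T = (THE S. S \<in> bounded_ops \<and> (\<forall>j k. entry S j k = \<i> * of_int (j - k) * entry T j k))"

lemma d1_op_eqI:
  assumes "S \<in> bounded_ops" "\<And>j k. entry S j k = \<i> * of_int (j - k) * entry T j k"
  shows "d1_op T = S"
  unfolding d1_op_def
proof (rule the_equality)
  fix S' assume "S' \<in> bounded_ops \<and> (\<forall>j k. entry S' j k = \<i> * of_int (j - k) * entry T j k)"
  then show "S' = S"
    using assms by (intro bounded_ops_eqI) auto
qed (use assms in auto)

lemma Lip1_op_d1_op:
  assumes "T \<in> Lip1_op"
  shows "d1_op T \<in> bounded_ops" "entry (d1_op T) j k = \<i> * of_int (j - k) * entry T j k"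
  using assms d1_op_eqI unfolding Lip1_op_def by auto

section \<open>The bilateral shift and the algebra it generates\<close>

lift_definition shift_ell2 :: "int \<Rightarrow> ell2 \<Rightarrow> ell2" is "\<lambda>n x j. x (j - n)"
proof -
  fix n :: int and x :: "int \<Rightarrow> complex"
  assume "(\<lambda>j. (cmod (x j))\<^sup>2) summable_on UNIV"
  moreover have "bij_betw (\<lambda>j. j - n) UNIV (UNIV :: int set)"
    by (rule bij_betw_byWitness[where f' = "\<lambda>j. j + n"]) auto
  ultimately show "(\<lambda>j. (cmod (x (j - n)))\<^sup>2) summable_on UNIV"
    using summable_on_reindex_bij_betw[of "\<lambda>j. j - n" UNIV UNIV "\<lambda>j. (cmod (x j))\<^sup>2"] by simp
qed

lemma coord_shift [simp]: "coord (shift_ell2 n x) j = coord x (j - n)"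
  by (simp add: shift_ell2.rep_eq)

lemma norm_shift [simp]: "norm (shift_ell2 n x) = norm x"
proof -
  have "bij_betw (\<lambda>j. j - n) UNIV (UNIV :: int set)"
    by (rule bij_betw_byWitness[where f' = "\<lambda>j. j + n"]) auto
  then have "((\<lambda>j. (cmod (coord (shift_ell2 n x) j))\<^sup>2) has_sum (norm x)\<^sup>2) UNIV"
    unfolding coord_shift
    using has_sum_reindex_bij_betw[of "\<lambda>j. j - n" UNIV UNIV "\<lambda>j. (cmod (coord x j))\<^sup>2"] norm_ell2_has_sum[of x]
    by simp
  then have "(norm (shift_ell2 n x))\<^sup>2 = (norm x)\<^sup>2"
    by (rule has_sum_unique[OF norm_ell2_has_sum])
  then show ?thesis
    by (rule power2_eq_imp_eq) simp_all
qed

definition shift_op :: "int \<Rightarrow> rop"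
  where "shift_op n = Blinfun (shift_ell2 n)"

lemma shift_op_apply [simp]: "shift_op n x = shift_ell2 n x"
proof -
  have "bounded_linear (shift_ell2 n)"
    by (rule bounded_linear_intro[where K = 1]) (simp_all add: ell2_eq_iff)
  then show ?thesis
    by (simp add: shift_op_def bounded_linear_Blinfun_apply)
qed

abbreviation bilateral_shift :: rop
  where "bilateral_shift \<equiv> shift_op 1"

lemma bilateral_shift_ebasis: "bilateral_shift (ebasis j) = ebasis (j + 1)"
  by (auto simp: ell2_eq_iff)

definition cstar_subalgebra :: "rop set \<Rightarrow> bool"
  where "cstar_subalgebra A \<longleftrightarrow>
    A \<subseteq> bounded_ops \<and> 0 \<in> A \<and>
    (\<forall>S\<in>A. \<forall>T\<in>A. S + T \<in> A \<and> S o\<^sub>L T \<in> A) \<and>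
    (\<forall>c. \<forall>T\<in>A. cmul_op c T \<in> A) \<and>
    (\<forall>T\<in>A. \<forall>S\<in>bounded_ops. is_adjoint S T \<longrightarrow> S \<in> A) \<and>
    closed A"

definition Cstar_shift :: "rop set"
  where "Cstar_shift = cstar_subalgebra hull {bilateral_shift}"

text \<open>
  Functions on the circle are represented by functions on the complex plane whose values off the
  unit circle are irrelevant; hence equality of symbols is only required on \<open>sphere 0 1\<close>.
\<close>

definition C_circle :: "(complex \<Rightarrow> complex) set"
  where "C_circle = {f. continuous_on (sphere 0 1) f}"

definition circle_star_iso :: "((complex \<Rightarrow> complex) \<Rightarrow> rop) \<Rightarrow> bool"
  where "circle_star_iso \<Phi> \<longleftrightarrow>
    (\<forall>f\<in>C_circle. \<forall>g\<in>C_circle. \<Phi> f = \<Phi> g \<longleftrightarrow> (\<forall>z\<in>sphere 0 1. f z = g z)) \<and>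
    \<Phi> ` C_circle = Cstar_shift \<and>
    (\<forall>f\<in>C_circle. \<forall>g\<in>C_circle. \<Phi> (\<lambda>z. f z + g z) = \<Phi> f + \<Phi> g) \<and>
    (\<forall>f\<in>C_circle. \<forall>g\<in>C_circle. \<Phi> (\<lambda>z. f z * g z) = \<Phi> f o\<^sub>L \<Phi> g) \<and>
    (\<forall>c. \<forall>f\<in>C_circle. \<Phi> (\<lambda>z. c * f z) = cmul_op c (\<Phi> f)) \<and>
    (\<forall>f\<in>C_circle. is_adjoint (\<Phi> (\<lambda>z. cnj (f z))) (\<Phi> f)) \<and>
    \<Phi> (\<lambda>z. z) = bilateral_shift"

text \<open>
  The identification of \<open>C(S\<^sup>1)\<close> with \<open>C\<^sup>*(U)\<close>.  On \<open>C_circle\<close> it does not depend on the choice: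
  see \<open>circle_star_iso_exists\<close>, \<open>circle_star_iso_unique\<close> and \<open>circle_op_iso\<close> below.
\<close>

definition circle_op :: "(complex \<Rightarrow> complex) \<Rightarrow> rop"
  where "circle_op = (SOME \<Phi>. circle_star_iso \<Phi>)"

definition Lip1_circle :: "(complex \<Rightarrow> complex) set"
  where "Lip1_circle = {f \<in> C_circle. circle_op f \<in> Lip1_op}"

section \<open>Arc length and Lipschitz constants\<close>

text \<open>
  Since \<open>Arg\<close> takes values in the interval from \<open>-\<pi>\<close> (excluded) to \<open>\<pi>\<close>, this is the length of the
  shorter arc: the least \<open>\<bar>t\<bar>\<close> such that \<open>z = w * cis t\<close>, see \<open>arc_dist_le\<close> and \<open>arc_dist_attained\<close>.
\<close>

definition arc_dist :: "complex \<Rightarrow> complex \<Rightarrow> real"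
  where "arc_dist z w = \<bar>Arg (z / w)\<bar>"

lemma abs_Arg_cis_le: "\<bar>Arg (cis t)\<bar> \<le> \<bar>t\<bar>"
proof (cases "- pi < t \<and> t \<le> pi")
  case True
  then have "Arg (cis t) = t"
    by (intro cis_Arg_unique) (auto simp: sgn_div_norm)
  then show ?thesis by simp
next
  case False
  then show ?thesis
    using Arg_bounded[of "cis t"] by linarith
qed

lemma arc_dist_le:
  assumes "w \<in> sphere 0 1" "z = w * cis t"
  shows "arc_dist z w \<le> \<bar>t\<bar>"
proof -
  have "z / w = cis t"
    using assms by auto
  then show ?thesis
    by (simp add: arc_dist_def abs_Arg_cis_le)
qed

lemma arc_dist_attained:
  assumes "z \<in> sphere 0 1" "w \<in> sphere 0 1"
  obtains t where "z = w * cis t" "\<bar>t\<bar> = arc_dist z w"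
proof
  have "cis (Arg (z / w)) = sgn (z / w)"
    using assms by (intro cis_Arg) auto
  also have "\<dots> = z / w"
    using assms by (simp add: sgn_div_norm norm_divide)
  finally show "z = w * cis (Arg (z / w))"
    using assms by auto
qed (simp add: arc_dist_def)

lemma Metric_space_arc: "Metric_space (sphere 0 1) arc_dist"
proof
  fix x y z :: complex
  show "0 \<le> arc_dist x y" by (simp add: arc_dist_def)
  show "arc_dist x y = arc_dist y x"
    using Arg_inverse[of "x / y"] by (simp add: arc_dist_def split: if_splits)
  assume x: "x \<in> sphere 0 1" and y: "y \<in> sphere 0 1"
  show "arc_dist x y = 0 \<longleftrightarrow> x = y"
  proof
    assume "arc_dist x y = 0"
    with arc_dist_attained[OF x y] show "x = y"
      by (metis abs_eq_0 cis_zero mult.right_neutral)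
  next
    assume "x = y"
    with y arc_dist_le[OF y, of x 0] show "arc_dist x y = 0"
      by (simp add: arc_dist_def)
  qed
  assume z: "z \<in> sphere 0 1"
  obtain s where s: "x = y * cis s" "\<bar>s\<bar> = arc_dist x y"
    using arc_dist_attained[OF x y] .
  obtain t where t: "y = z * cis t" "\<bar>t\<bar> = arc_dist y z"
    using arc_dist_attained[OF y z] .
  have "x = z * cis (t + s)"
    by (simp add: s(1) t(1) mult.assoc cis_mult)
  from arc_dist_le[OF z this] show "arc_dist x z \<le> arc_dist x y + arc_dist y z"
    using s(2) t(2) by linarith
qed

definition arc_metric :: "complex metric"
  where "arc_metric = metric (sphere 0 1, arc_dist)"

lemma arc_metric_simps [simp]:
  "mspace arc_metric = sphere 0 1" "mdist arc_metric = arc_dist"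
  by (simp_all add: arc_metric_def Metric_space.mspace_metric[OF Metric_space_arc]
      Metric_space.mdist_metric[OF Metric_space_arc])

definition Lipschitz_constant :: "'a metric \<Rightarrow> 'b metric \<Rightarrow> ('a \<Rightarrow> 'b) \<Rightarrow> real"
  where "Lipschitz_constant m1 m2 f =
    Inf {B. 0 \<le> B \<and> (\<forall>x\<in>mspace m1. \<forall>y\<in>mspace m1. mdist m2 (f x) (f y) \<le> B * mdist m1 x y)}"

section \<open>Existence and uniqueness of the identification\<close>

text \<open>
  Laurent polynomials in \<open>U\<close> have the sup norm of their symbol (Parseval's identity gives one
  inequality, approximate eigenvectors the other), and the identification is their completion.
\<close>

definition fin_supp :: "ell2 \<Rightarrow> bool"
  where "fin_supp x \<longleftrightarrow> finite {j. coord x j \<noteq> 0}"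

definition trig :: "ell2 \<Rightarrow> complex \<Rightarrow> complex"
  where "trig x z = (\<Sum>\<^sub>\<infinity>j. coord x j * z powi j)"

lemma fin_supp_summable:
  assumes "fin_supp x"
  shows "(\<lambda>j. coord x j * g j) summable_on UNIV"
proof -
  have "(\<lambda>j. coord x j * g j) summable_on {j. coord x j \<noteq> 0}"
    using assms by (intro summable_on_finite) (simp add: fin_supp_def)
  then show ?thesis
    by (rule summable_on_cong_neutral[THEN iffD1, rotated -1]) auto
qed

lemma trig_eq_sum:
  assumes "fin_supp x"
  shows "trig x z = (\<Sum>j | coord x j \<noteq> 0. coord x j * z powi j)"
proof -
  have "trig x z = (\<Sum>\<^sub>\<infinity>j\<in>{j. coord x j \<noteq> 0}. coord x j * z powi j)"
    unfolding trig_def by (rule infsum_cong_neutral) auto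
  then show ?thesis
    using assms by (simp add: fin_supp_def)
qed

lemma fin_supp_add: "fin_supp x \<Longrightarrow> fin_supp y \<Longrightarrow> fin_supp (x + y)"
  unfolding fin_supp_def
  by (rule finite_subset[where B = "{j. coord x j \<noteq> 0} \<union> {j. coord y j \<noteq> 0}"]) auto

lemma fin_supp_cscale: "fin_supp x \<Longrightarrow> fin_supp (cscale c x)"
  unfolding fin_supp_def by (erule finite_subset[rotated]) auto

lemma fin_supp_shift:
  assumes "fin_supp x"
  shows "fin_supp (shift_ell2 n x)"
proof -
  have "{j. coord x (j - n) \<noteq> 0} \<subseteq> (\<lambda>j. j + n) ` {j. coord x j \<noteq> 0}"
    by (auto intro!: image_eqI[where x = "_ - n"])
  then show ?thesis
    using assms unfolding fin_supp_def by (simp add: finite_subset)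
qed

lemma trig_add: "fin_supp x \<Longrightarrow> fin_supp y \<Longrightarrow> trig (x + y) z = trig x z + trig y z"
  by (simp add: trig_def distrib_right infsum_add fin_supp_summable)

lemma trig_cscale: "trig (cscale c x) z = c * trig x z"
  by (simp add: trig_def mult.assoc infsum_cmult_right')

lemma trig_shift:
  assumes "z \<noteq> 0"
  shows "trig (shift_ell2 n x) z = z powi n * trig x z"
proof -
  have bij: "bij_betw (\<lambda>j. j - n) UNIV (UNIV :: int set)"
    by (rule bij_betw_byWitness[where f' = "\<lambda>j. j + n"]) auto
  have "coord x (j - n) * z powi j = z powi n * (coord x (j - n) * z powi (j - n))" for j
    using assms power_int_add[of z n "j - n"] by simp
  then have "trig (shift_ell2 n x) z = (\<Sum>\<^sub>\<infinity>j. z powi n * (coord x (j - n) * z powi (j - n)))"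
    by (simp only: trig_def coord_shift)
  also have "\<dots> = z powi n * trig x z"
    unfolding infsum_cmult_right' trig_def
    using infsum_reindex_bij_betw[OF bij, of "\<lambda>j. coord x j * z powi j"] by simp
  finally show ?thesis .
qed

lemma has_integral_cis:
  "((\<lambda>t. cis (of_int m * t)) has_integral (if m = 0 then of_real (2 * pi) else 0)) {0..2 * pi}"
proof (cases "m = 0")
  case True
  then show ?thesis
    using has_integral_const_real[of "1 :: complex" 0 "2 * pi"] by (simp add: scaleR_conv_of_real)
next
  case False
  let ?F = "\<lambda>t. exp (\<i> * of_int m * of_real t) / (\<i> * of_int m)"
  have "((\<lambda>t. exp (\<i> * of_int m * of_real t)) has_integral (?F (2 * pi) - ?F 0)) {0..2 * pi}"
  proof (rule fundamental_theorem_of_calculus)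
    fix t :: real
    have "((\<lambda>w. exp (\<i> * of_int m * w) / (\<i> * of_int m)) has_field_derivative exp (\<i> * of_int m * of_real t))
            (at (of_real t))"
      using False by (auto intro!: derivative_eq_intros)
    from has_vector_derivative_real_field[OF this]
    show "(?F has_vector_derivative exp (\<i> * of_int m * of_real t)) (at t within {0..2 * pi})"
      by simp
  qed simp
  moreover have "exp (\<i> * of_int m * of_real (2 * pi)) = 1"
    using exp_integer_2pi[of "of_int m"] by (simp add: mult_ac)
  moreover have "exp (\<i> * of_int m * of_real t) = cis (of_int m * t)" for t
    by (simp add: cis_conv_exp mult_ac)
  ultimately show ?thesis
    using False by simp
qed

lemma parseval:
  assumes "fin_supp x"
  shows "((\<lambda>t. (cmod (trig x (cis t)))\<^sup>2) has_integral (2 * pi * (norm x)\<^sup>2)) {0..2 * pi}"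
proof -
  let ?S = "{j. coord x j \<noteq> 0}" and ?a = "coord x"
  have fin: "finite ?S"
    using assms by (simp add: fin_supp_def)
  have "((\<lambda>j. (cmod (?a j))\<^sup>2) has_sum (\<Sum>j\<in>?S. (cmod (?a j))\<^sup>2)) ?S"
    using fin by (intro has_sum_finite)
  then have "((\<lambda>j. (cmod (?a j))\<^sup>2) has_sum (\<Sum>j\<in>?S. (cmod (?a j))\<^sup>2)) UNIV"
    by (rule has_sum_cong_neutral[THEN iffD1, rotated -1]) auto
  from has_sum_unique[OF norm_ell2_has_sum this]
  have nx: "(norm x)\<^sup>2 = (\<Sum>j\<in>?S. (cmod (?a j))\<^sup>2)" .
  have "((\<lambda>t. \<Sum>j\<in>?S. \<Sum>k\<in>?S. (?a j * cnj (?a k)) * cis (of_int (j - k) * t)) has_integral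
      (\<Sum>j\<in>?S. \<Sum>k\<in>?S. (?a j * cnj (?a k)) * (if j - k = 0 then of_real (2 * pi) else 0))) {0..2 * pi}"
    by (intro has_integral_sum has_integral_mult_right has_integral_cis fin)
  moreover have "(\<Sum>j\<in>?S. \<Sum>k\<in>?S. (?a j * cnj (?a k)) * cis (of_int (j - k) * t))
      = of_real ((cmod (trig x (cis t)))\<^sup>2)" for t
  proof -
    have "of_real ((cmod (trig x (cis t)))\<^sup>2) = trig x (cis t) * cnj (trig x (cis t))"
      by (rule complex_norm_square)
    also have "\<dots> = (\<Sum>j\<in>?S. \<Sum>k\<in>?S. (?a j * cis t powi j) * cnj (?a k * cis t powi k))"
      by (simp add: trig_eq_sum[OF assms] sum_product)
    also have "\<dots> = (\<Sum>j\<in>?S. \<Sum>k\<in>?S. (?a j * cnj (?a k)) * cis (of_int (j - k) * t))"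
      by (intro sum.cong refl) (simp add: cis_power_int cis_cnj cis_mult[symmetric] left_diff_distrib
          cis_divide[symmetric] divide_inverse)
    finally show ?thesis by simp
  qed
  moreover have "(\<Sum>j\<in>?S. \<Sum>k\<in>?S. (?a j * cnj (?a k)) * (if j - k = 0 then of_real (2 * pi) else 0))
      = of_real (2 * pi * (norm x)\<^sup>2)"
  proof -
    have "(\<Sum>k\<in>?S. (?a j * cnj (?a k)) * (if j - k = 0 then of_real (2 * pi) else 0))
      = of_real (2 * pi * (cmod (?a j))\<^sup>2)" if "j \<in> ?S" for j
    proof -
      have "(\<Sum>k\<in>?S. (?a j * cnj (?a k)) * (if j - k = 0 then of_real (2 * pi) else 0))
          = (\<Sum>k\<in>?S. if j = k then ?a j * cnj (?a j) * of_real (2 * pi) else 0)"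
        by (intro sum.cong) auto
      also have "\<dots> = ?a j * cnj (?a j) * of_real (2 * pi)"
        using that fin by simp
      also have "\<dots> = of_real (2 * pi * (cmod (?a j))\<^sup>2)"
        unfolding of_real_mult complex_norm_square by (simp only: mult_ac)
      finally show ?thesis .
    qed
    then show ?thesis
      by (simp add: nx sum_distrib_left)
  qed
  ultimately have "((\<lambda>t. complex_of_real ((cmod (trig x (cis t)))\<^sup>2)) has_integral of_real (2 * pi * (norm x)\<^sup>2)) {0..2 * pi}"
    by simp
  from has_integral_linear[OF this bounded_linear_Re] show ?thesis
    by (simp add: o_def)
qed

inductive laurent :: "(complex \<Rightarrow> complex) \<Rightarrow> rop \<Rightarrow> bool" where
  powi: "laurent (\<lambda>z. z powi n) (shift_op n)"
| add: "laurent f S \<Longrightarrow> laurent g T \<Longrightarrow> laurent (\<lambda>z. f z + g z) (S + T)"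
| cmul: "laurent f S \<Longrightarrow> laurent (\<lambda>z. c * f z) (cmul_op c S)"
| cong: "laurent f S \<Longrightarrow> (\<And>z. z \<in> sphere 0 1 \<Longrightarrow> f z = g z) \<Longrightarrow> laurent g S"

lemma laurent_trig:
  assumes "laurent f S" "fin_supp x"
  shows "fin_supp (S x) \<and> (\<forall>z\<in>sphere 0 1. trig (S x) z = f z * trig x z)"
  using assms
proof (induction)
  case (powi n)
  then show ?case
    by (auto simp: fin_supp_shift intro: trig_shift)
next
  case (add f S g T)
  then show ?case
    by (simp add: blinfun.add_left trig_add fin_supp_add distrib_right)
next
  case (cmul f S c)
  then show ?case
    by (simp add: trig_cscale fin_supp_cscale)
next
  case (cong f S g)
  have "trig (S x) z = g z * trig x z" if "z \<in> sphere 0 1" for z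
    using cong.IH[OF cong.prems] cong.hyps(2)[OF that] that by simp
  with cong.IH[OF cong.prems] show ?case
    by blast
qed

lemma bounded_ops_D: "T \<in> bounded_ops \<Longrightarrow> T (cscale c x) = cscale c (T x)"
  by (simp add: bounded_ops_def)

lemma bounded_ops_shift: "shift_op n \<in> bounded_ops"
  by (simp add: bounded_ops_def ell2_eq_iff)

lemma bounded_ops_add: "S \<in> bounded_ops \<Longrightarrow> T \<in> bounded_ops \<Longrightarrow> S + T \<in> bounded_ops"
  by (simp add: bounded_ops_def blinfun.add_left cscale_add)

lemma bounded_ops_comp: "S \<in> bounded_ops \<Longrightarrow> T \<in> bounded_ops \<Longrightarrow> S o\<^sub>L T \<in> bounded_ops"
  by (simp add: bounded_ops_def)

lemma bounded_ops_cmul: "T \<in> bounded_ops \<Longrightarrow> cmul_op c T \<in> bounded_ops"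
  by (simp add: bounded_ops_def ell2_eq_iff mult.left_commute)

lemma closed_bounded_ops: "closed bounded_ops"
proof -
  have eq: "bounded_ops = (\<Inter>c. \<Inter>x. {T :: rop. T (cscale c x) = cscale c (T x)})"
    by (auto simp: bounded_ops_def)
  have cl: "closed {T :: rop. T (cscale c x) = cscale c (T x)}" for c x
    by (intro closed_Collect_eq continuous_intros bounded_linear.continuous_on[OF bounded_linear_cscale])
  show ?thesis
    unfolding eq by (intro closed_INT ballI cl)
qed

lemma laurent_bounded_ops: "laurent f S \<Longrightarrow> S \<in> bounded_ops"
  by (induction rule: laurent.induct)
    (auto intro: bounded_ops_shift bounded_ops_add bounded_ops_cmul)

lemma fin_supp_partial: "finite F \<Longrightarrow> fin_supp (\<Sum>k\<in>F. cscale (coord x k) (ebasis k))"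
  unfolding fin_supp_def
  by (rule finite_subset[of _ F]) (auto simp: sum.neutral intro: ccontr)

lemma laurent_norm_le:
  assumes "laurent f S" "\<And>z. z \<in> sphere 0 1 \<Longrightarrow> cmod (f z) \<le> B"
  shows "norm S \<le> B"
proof -
  have B: "0 \<le> B"
    using assms(2)[of 1] norm_ge_zero[of "f 1"] by (simp del: norm_ge_zero)
  have fin: "norm (S x) \<le> B * norm x" if x: "fin_supp x" for x
  proof -
    note tr = laurent_trig[OF assms(1) x]
    have "2 * pi * (norm (S x))\<^sup>2 \<le> B\<^sup>2 * (2 * pi * (norm x)\<^sup>2)"
    proof (rule has_integral_le)
      show "((\<lambda>t. (cmod (trig (S x) (cis t)))\<^sup>2) has_integral (2 * pi * (norm (S x))\<^sup>2)) {0..2 * pi}"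
        using tr by (intro parseval) auto
      show "((\<lambda>t. B\<^sup>2 * (cmod (trig x (cis t)))\<^sup>2) has_integral (B\<^sup>2 * (2 * pi * (norm x)\<^sup>2))) {0..2 * pi}"
        by (intro has_integral_mult_right parseval x)
      fix t :: real
      have "cmod (trig (S x) (cis t)) \<le> B * cmod (trig x (cis t))"
        using tr assms(2)[of "cis t"] by (simp add: norm_mult mult_right_mono)
      from power_mono[OF this norm_ge_zero, of 2]
      show "(cmod (trig (S x) (cis t)))\<^sup>2 \<le> B\<^sup>2 * (cmod (trig x (cis t)))\<^sup>2"
        by (simp add: power_mult_distrib)
    qed
    then have "(norm (S x))\<^sup>2 \<le> (B * norm x)\<^sup>2"
      by (simp add: power_mult_distrib)
    then show ?thesis
      by (rule power2_le_imp_le) (use B in simp)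
  qed
  show ?thesis
  proof (rule norm_blinfun_bound[OF B])
    fix x
    have lim: "((\<lambda>F. \<Sum>k\<in>F. cscale (coord x k) (ebasis k)) \<longlongrightarrow> x) (finite_subsets_at_top UNIV)"
      using ebasis_has_sum[of x] by (simp add: has_sum_def)
    show "norm (S x) \<le> B * norm x"
    proof (rule tendsto_le)
      show "((\<lambda>F. norm (S (\<Sum>k\<in>F. cscale (coord x k) (ebasis k)))) \<longlongrightarrow> norm (S x)) (finite_subsets_at_top UNIV)"
        by (intro tendsto_intros lim)
      show "((\<lambda>F. B * norm (\<Sum>k\<in>F. cscale (coord x k) (ebasis k))) \<longlongrightarrow> B * norm x) (finite_subsets_at_top UNIV)"
        by (intro tendsto_intros lim)
      show "\<forall>\<^sub>F F in finite_subsets_at_top UNIV. norm (S (\<Sum>k\<in>F. cscale (coord x k) (ebasis k)))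
          \<le> B * norm (\<Sum>k\<in>F. cscale (coord x k) (ebasis k))"
        by (intro eventually_finite_subsets_at_top_weakI fin fin_supp_partial)
    qed simp
  qed
qed

lemma laurent_approx_eigenvector:
  fixes z :: complex and N :: nat
  assumes z: "z \<in> sphere 0 1"
  defines "v \<equiv> \<lambda>N::nat. \<Sum>k = 0..<int N. cscale (z powi (- k)) (ebasis k)"
  shows "(norm (v N))\<^sup>2 = N" and "laurent f S \<Longrightarrow> \<exists>C. \<forall>N. norm (S (v N) - cscale (f z) (v N)) \<le> C"
proof -
  have z0: "z \<noteq> 0" and nz: "cmod (z powi j) = 1" for j
    using z by (auto simp: norm_power_int)
  have c: "coord (v N) j = (if 0 \<le> j \<and> j < int N then z powi (- j) else 0)" for N j
  proof -
    have "coord (v N) j = (\<Sum>k = 0..<int N. if k = j then z powi (- j) else 0)"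
      unfolding v_def coord_sum by (intro sum.cong) auto
    then show ?thesis by simp
  qed
  have "((\<lambda>j. (cmod (coord (v N) j))\<^sup>2) has_sum (\<Sum>j = 0..<int N. (cmod (coord (v N) j))\<^sup>2)) {0..<int N}"
    by (intro has_sum_finite) simp
  then have "((\<lambda>j. (cmod (coord (v N) j))\<^sup>2) has_sum (\<Sum>j = 0..<int N. (cmod (coord (v N) j))\<^sup>2)) UNIV"
    by (rule has_sum_cong_neutral[THEN iffD1, rotated -1]) (auto simp: c)
  from has_sum_unique[OF norm_ell2_has_sum this]
  show "(norm (v N))\<^sup>2 = N"
    by (simp add: c nz)
  show "\<exists>C. \<forall>N. norm (S (v N) - cscale (f z) (v N)) \<le> C" if "laurent f S"
    using that
  proof (induction)
    case (powi n)
    have "norm (shift_op n (v N) - cscale (z powi n) (v N)) \<le> sqrt (4 * real_of_int \<bar>n\<bar> + 2)" for N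
    proof -
      let ?d = "shift_op n (v N) - cscale (z powi n) (v N)"
      let ?A = "{- \<bar>n\<bar>..\<bar>n\<bar>} \<union> {int N - \<bar>n\<bar>..int N + \<bar>n\<bar>}"
      have d: "coord ?d j = coord (v N) (j - n) - z powi n * coord (v N) j" for j
        by simp
      have e: "z powi (n - j) = z powi n * z powi (- j)" for j
        using z0 power_int_add[of z n "- j"] by simp
      have le1: "cmod (coord ?d j) \<le> 1" for j
        unfolding d c by (simp add: e nz norm_mult)
      have zero: "coord ?d j = 0" if "j \<notin> ?A" for j
        using that unfolding d c by (auto simp: e)
      have "((\<lambda>j. (cmod (coord ?d j))\<^sup>2) has_sum (\<Sum>j\<in>?A. (cmod (coord ?d j))\<^sup>2)) ?A"
        by (intro has_sum_finite) simp
      then have "((\<lambda>j. (cmod (coord ?d j))\<^sup>2) has_sum (\<Sum>j\<in>?A. (cmod (coord ?d j))\<^sup>2)) UNIV"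
        by (rule has_sum_cong_neutral[THEN iffD1, rotated -1]) (use zero in auto)
      from has_sum_unique[OF norm_ell2_has_sum this]
      have "(norm ?d)\<^sup>2 = (\<Sum>j\<in>?A. (cmod (coord ?d j))\<^sup>2)" .
      also have "\<dots> \<le> (\<Sum>j\<in>?A. 1)"
        by (intro sum_mono power_le_one le1) simp
      also have "\<dots> \<le> real (card {- \<bar>n\<bar>..\<bar>n\<bar>} + card {int N - \<bar>n\<bar>..int N + \<bar>n\<bar>})"
        using card_Un_le[of "{- \<bar>n\<bar>..\<bar>n\<bar>}" "{int N - \<bar>n\<bar>..int N + \<bar>n\<bar>}"]
        by (simp only: sum_constant mult_1_right of_nat_le_iff of_nat_1 mult_1)
      also have "\<dots> = 4 * real_of_int \<bar>n\<bar> + 2"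
        by simp
      finally show ?thesis
        by (rule real_le_rsqrt)
    qed
    then show ?case by blast
  next
    case (add f S g T)
    then obtain C D where "\<And>N. norm (S (v N) - cscale (f z) (v N)) \<le> C"
      "\<And>N. norm (T (v N) - cscale (g z) (v N)) \<le> D"
      by blast
    moreover have "(S + T) x - cscale (f z + g z) x = (S x - cscale (f z) x) + (T x - cscale (g z) x)" for x
      by (simp add: blinfun.add_left ell2_eq_iff algebra_simps)
    ultimately have "norm ((S + T) (v N) - cscale (f z + g z) (v N)) \<le> C + D" for N
      by (metis norm_triangle_mono)
    then show ?case by blast
  next
    case (cmul f S c)
    then obtain C where C: "\<And>N. norm (S (v N) - cscale (f z) (v N)) \<le> C"
      by blast
    have "cmul_op c S x - cscale (c * f z) x = cscale c (S x - cscale (f z) x)" for x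
      by (simp add: ell2_eq_iff algebra_simps)
    then have "norm (cmul_op c S (v N) - cscale (c * f z) (v N)) \<le> cmod c * C" for N
      by (simp only: norm_cscale) (intro mult_left_mono C norm_ge_zero)
    then show ?case by blast
  next
    case (cong f S g)
    then show ?case using z by metis
  qed
qed

lemma laurent_le_norm:
  assumes "laurent f S" "z \<in> sphere 0 1"
  shows "cmod (f z) \<le> norm S"
proof (rule ccontr)
  define v where "v = (\<lambda>N::nat. \<Sum>k = 0..<int N. cscale (z powi (- k)) (ebasis k))"
  have v: "(norm (v N))\<^sup>2 = N" for N
    unfolding v_def by (rule laurent_approx_eigenvector(1)[OF assms(2)])
  obtain C where C: "\<And>N. norm (S (v N) - cscale (f z) (v N)) \<le> C"
    using laurent_approx_eigenvector(2)[OF assms(2,1)] unfolding v_def by blast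
  assume "\<not> cmod (f z) \<le> norm S"
  then have d: "cmod (f z) - norm S > 0" (is "?d > 0") by simp
  obtain N :: nat where N: "N > (C / ?d)\<^sup>2"
    using reals_Archimedean2 by blast
  have "cmod (f z) * norm (v N) = norm (cscale (f z) (v N))"
    by simp
  also have "\<dots> \<le> norm (S (v N)) + norm (S (v N) - cscale (f z) (v N))"
    by (metis norm_minus_commute norm_triangle_sub)
  also have "\<dots> \<le> norm S * norm (v N) + C"
    by (intro add_mono norm_blinfun C)
  finally have "?d * norm (v N) \<le> C"
    by (simp add: left_diff_distrib)
  then have "norm (v N) \<le> C / ?d"
    using d by (simp add: pos_le_divide_eq mult.commute)
  then have "(norm (v N))\<^sup>2 \<le> (C / ?d)\<^sup>2"
    by (intro power_mono) auto
  with N v show False by simp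
qed

lemma laurent_minus:
  assumes "laurent f S" "laurent g T"
  shows "laurent (\<lambda>z. f z - g z) (S - T)"
proof -
  have "S + cmul_op (- 1) T = S - T"
    by (rule blinfun_eqI) (simp add: blinfun.add_left blinfun.diff_left ell2_eq_iff)
  with laurent.add[OF assms(1) laurent.cmul[OF assms(2), of "- 1"]] show ?thesis
    by simp
qed

lemma laurent_const: "laurent (\<lambda>z. c) (cmul_op c (shift_op 0))"
  using laurent.cmul[OF laurent.powi[of 0], of c] by simp

lemma laurent_mult_powi:
  assumes "laurent g T"
  shows "laurent (\<lambda>z. z powi n * g z) (shift_op n o\<^sub>L T)"
  using assms
proof (induction)
  case (powi m)
  have "shift_op n o\<^sub>L shift_op m = shift_op (n + m)"
    by (rule blinfun_eqI) (simp add: ell2_eq_iff algebra_simps)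
  then show ?case
    by (auto intro!: laurent.cong[OF laurent.powi[of "n + m"]] power_int_add)
next
  case (add f S g T)
  have "shift_op n o\<^sub>L (S + T) = (shift_op n o\<^sub>L S) + (shift_op n o\<^sub>L T)"
    by (rule blinfun_eqI) (simp add: blinfun.add_left ell2_eq_iff)
  then show ?case
    using laurent.add[OF add.IH] by (simp add: distrib_left)
next
  case (cmul f S c)
  have "shift_op n o\<^sub>L (cmul_op c S) = cmul_op c (shift_op n o\<^sub>L S)"
    by (rule blinfun_eqI) (simp add: ell2_eq_iff)
  then show ?case
    using laurent.cmul[OF cmul.IH, of c] by (simp add: mult.left_commute)
next
  case (cong f S g)
  then show ?case by (auto intro: laurent.cong)
qed

lemma laurent_mult:
  assumes "laurent f S" "laurent g T"
  shows "laurent (\<lambda>z. f z * g z) (S o\<^sub>L T)"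
  using assms(1)
proof (induction)
  case (powi n)
  show ?case by (rule laurent_mult_powi[OF assms(2)])
next
  case (add f S f' S')
  have "(S + S') o\<^sub>L T = (S o\<^sub>L T) + (S' o\<^sub>L T)"
    by (rule blinfun_eqI) (simp add: blinfun.add_left)
  then show ?case
    using laurent.add[OF add.IH] by (simp add: distrib_right)
next
  case (cmul f S c)
  have "cmul_op c S o\<^sub>L T = cmul_op c (S o\<^sub>L T)"
    by (rule blinfun_eqI) simp
  then show ?case
    using laurent.cmul[OF cmul.IH, of c] by (simp add: mult.assoc)
next
  case (cong f S g')
  then show ?case by (auto intro: laurent.cong)
qed

lemma cinner_ext: "(\<And>y. cinner x y = cinner x' y) \<Longrightarrow> x = x'"
  by (metis cinner_commute cinner_ebasis_left ell2_eqI)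

lemma is_adjoint_unique: "is_adjoint S T \<Longrightarrow> is_adjoint S' T \<Longrightarrow> S = S'"
  unfolding is_adjoint_def by (intro blinfun_eqI cinner_ext) simp

lemma is_adjoint_sym: "is_adjoint S T \<Longrightarrow> is_adjoint T S"
  unfolding is_adjoint_def by (metis cinner_commute)

lemma is_adjoint_shift: "is_adjoint (shift_op (- n)) (shift_op n)"
proof -
  have bij: "bij_betw (\<lambda>j. j - n) UNIV (UNIV :: int set)"
    by (rule bij_betw_byWitness[where f' = "\<lambda>j. j + n"]) auto
  have "cinner (shift_ell2 (- n) x) y = cinner x (shift_ell2 n y)" for x y
    using infsum_reindex_bij_betw[OF bij, of "\<lambda>j. cnj (coord x (j + n)) * coord y j"]
    by (simp add: cinner_def)
  then show ?thesis
    by (simp add: is_adjoint_def)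
qed

lemma circle_inverse:
  fixes z :: complex
  assumes "z \<in> sphere 0 1"
  shows "inverse z = cnj z"
proof (rule inverse_unique)
  show "z * cnj z = 1"
    using assms complex_norm_square[of z] by simp
qed

lemma laurent_cnj:
  assumes "laurent f S"
  shows "\<exists>T. laurent (\<lambda>z. cnj (f z)) T \<and> is_adjoint T S"
  using assms
proof (induction)
  case (powi n)
  have "z powi (- n) = cnj (z powi n)" if "z \<in> sphere 0 1" for z :: complex
  proof -
    have "z powi (- n) = (inverse z) powi n"
      by (simp add: power_int_minus power_int_inverse)
    then show ?thesis
      by (simp add: circle_inverse[OF that])
  qed
  then show ?case
    using laurent.cong[OF laurent.powi[of "- n"]] is_adjoint_shift by metis
next
  case (add f S g T)
  then obtain S' T' where "laurent (\<lambda>z. cnj (f z)) S'" "is_adjoint S' S"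
    "laurent (\<lambda>z. cnj (g z)) T'" "is_adjoint T' T"
    by blast
  then have "laurent (\<lambda>z. cnj (f z + g z)) (S' + T') \<and> is_adjoint (S' + T') (S + T)"
    using laurent.add unfolding is_adjoint_def
    by (simp add: blinfun.add_left cinner_add_left cinner_add_right)
  then show ?case by blast
next
  case (cmul f S c)
  then obtain S' where "laurent (\<lambda>z. cnj (f z)) S'" "is_adjoint S' S"
    by blast
  then have "laurent (\<lambda>z. cnj (c * f z)) (cmul_op (cnj c) S') \<and> is_adjoint (cmul_op (cnj c) S') (cmul_op c S)"
    using laurent.cmul unfolding is_adjoint_def
    by (simp add: cinner_cscale_left cinner_cscale_right)
  then show ?case by blast
next
  case (cong f S g)
  then obtain T where T: "laurent (\<lambda>z. cnj (f z)) T" "is_adjoint T S" by blast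
  have "laurent (\<lambda>z. cnj (g z)) T"
    by (rule laurent.cong[OF T(1)]) (simp add: cong.hyps)
  with T(2) show ?case by blast
qed

lemma cstar_subalgebra_shift:
  assumes A: "cstar_subalgebra A" and 1: "bilateral_shift \<in> A"
  shows "shift_op n \<in> A"
proof -
  have "shift_op (- 1) \<in> A"
    using A 1 is_adjoint_shift[of 1] bounded_ops_shift unfolding cstar_subalgebra_def by blast
  have comp: "shift_op (m + k) \<in> A" if "shift_op m \<in> A" "shift_op k \<in> A" for m k
  proof -
    have "shift_op m o\<^sub>L shift_op k = shift_op (m + k)"
      by (rule blinfun_eqI) (simp add: ell2_eq_iff algebra_simps)
    with A that show ?thesis
      unfolding cstar_subalgebra_def by metis
  qed
  show ?thesis
  proof (induction n rule: int_induct[where k = 0])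
    case base
    then show ?case using comp[OF 1 \<open>shift_op (- 1) \<in> A\<close>] by simp
  next
    case (step1 i)
    then show ?case using comp[OF _ 1] by simp
  next
    case (step2 i)
    then show ?case using comp[OF _ \<open>shift_op (- 1) \<in> A\<close>] by simp
  qed
qed

lemma cstar_subalgebra_laurent:
  assumes A: "cstar_subalgebra A" and 1: "bilateral_shift \<in> A" and "laurent f S"
  shows "S \<in> A"
  using assms(3)
proof (induction)
  case (powi n)
  show ?case by (rule cstar_subalgebra_shift[OF A 1])
qed (use A in \<open>auto simp: cstar_subalgebra_def\<close>)

lemma laurent_real_polynomial:
  fixes p :: "complex \<Rightarrow> real"
  assumes "real_polynomial_function p"
  shows "\<exists>S. laurent (\<lambda>z. of_real (p z)) S"
  using assms
proof (induction)
  case (linear p)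
  then interpret bounded_linear p .
  define a b where "a = (of_real (p 1) - \<i> * of_real (p \<i>)) / 2"
    and "b = (of_real (p 1) + \<i> * of_real (p \<i>)) / 2"
  have "laurent (\<lambda>z. a * z powi 1 + b * z powi (- 1)) (cmul_op a (shift_op 1) + cmul_op b (shift_op (- 1)))"
    by (rule laurent.add[OF laurent.cmul[OF laurent.powi] laurent.cmul[OF laurent.powi]])
  moreover have "a * z powi 1 + b * z powi (- 1) = of_real (p z)" if "z \<in> sphere 0 1" for z
  proof -
    have "a * z powi 1 + b * z powi (- 1) = a * z + b * cnj z"
      by (simp add: power_int_minus circle_inverse[OF that])
    also have "\<dots> = of_real (Re z * p 1 + Im z * p \<i>)"
      by (simp add: a_def b_def complex_eq_iff field_simps)
    also have "Re z * p 1 + Im z * p \<i> = p z"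
    proof -
      have "z = Re z *\<^sub>R 1 + Im z *\<^sub>R \<i>"
        by (simp add: complex_eq_iff)
      then show ?thesis
        by (metis add scaleR real_scaleR_def)
    qed
    finally show ?thesis .
  qed
  ultimately show ?case
    by (intro exI) (rule laurent.cong)
next
  case (const c)
  show ?case using laurent_const by blast
next
  case (add f g)
  then show ?case by (auto intro: laurent.add)
next
  case (mult f g)
  then show ?case by (auto intro: laurent_mult)
qed

lemma laurent_polynomial:
  fixes p :: "complex \<Rightarrow> complex"
  assumes "polynomial_function p"
  shows "\<exists>S. laurent p S"
proof -
  have "real_polynomial_function (Re \<circ> p)" "real_polynomial_function (Im \<circ> p)"
    using assms bounded_linear_Re bounded_linear_Im unfolding polynomial_function_def by auto
  then obtain S T where "laurent (\<lambda>z. of_real (Re (p z))) S" "laurent (\<lambda>z. of_real (Im (p z))) T"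
    using laurent_real_polynomial by fastforce
  then have "laurent (\<lambda>z. of_real (Re (p z)) + \<i> * of_real (Im (p z))) (S + cmul_op \<i> T)"
    by (intro laurent.add laurent.cmul)
  moreover have "(\<lambda>z. of_real (Re (p z)) + \<i> * of_real (Im (p z))) = p"
    by (rule ext) (simp add: complex_eq_iff)
  ultimately show ?thesis by auto
qed

lemma laurent_continuous: "laurent f S \<Longrightarrow> continuous_on (sphere 0 1) f"
proof (induction rule: laurent.induct)
  case (powi n)
  show ?case by (intro continuous_intros) auto
next
  case (cong f S g)
  then show ?case by (simp cong: continuous_on_cong_simp)
qed (auto intro: continuous_intros)

definition has_symbol :: "rop \<Rightarrow> (complex \<Rightarrow> complex) \<Rightarrow> bool"
  where "has_symbol T f \<longleftrightarrow> (\<exists>g S. (\<forall>n. laurent (g n) (S n)) \<and> S \<longlonglongrightarrow> T \<and>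
    (\<forall>z\<in>sphere 0 1. (\<lambda>n. g n z) \<longlonglongrightarrow> f z))"

lemma has_symbolE:
  assumes "has_symbol T f"
  obtains g S where "\<And>n. laurent (g n) (S n)" "S \<longlonglongrightarrow> T"
    "\<And>z. z \<in> sphere 0 1 \<Longrightarrow> (\<lambda>n. g n z) \<longlonglongrightarrow> f z"
  using assms unfolding has_symbol_def by blast

lemma laurent_has_symbol: "laurent f S \<Longrightarrow> has_symbol S f"
  unfolding has_symbol_def by (intro exI[of _ "\<lambda>_. f"] exI[of _ "\<lambda>_. S"]) simp

lemma has_symbol_le_norm:
  assumes "has_symbol T f" "z \<in> sphere 0 1"
  shows "cmod (f z) \<le> norm T"
proof -
  obtain g S where gS: "\<And>n. laurent (g n) (S n)" "S \<longlonglongrightarrow> T" "\<And>z. z \<in> sphere 0 1 \<Longrightarrow> (\<lambda>n. g n z) \<longlonglongrightarrow> f z"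
    using assms(1) unfolding has_symbol_def by blast
  show ?thesis
    by (rule LIMSEQ_le[OF tendsto_norm[OF gS(3)[OF assms(2)]] tendsto_norm[OF gS(2)]])
      (use laurent_le_norm[OF gS(1) assms(2)] in blast)
qed

lemma has_symbol_approx:
  assumes gS: "\<And>n. laurent (g n) (S n)" "S \<longlonglongrightarrow> T" "\<And>z. z \<in> sphere 0 1 \<Longrightarrow> (\<lambda>n. g n z) \<longlonglongrightarrow> f z"
    and z: "z \<in> sphere 0 1"
  shows "cmod (g n z - f z) \<le> norm (S n - T)"
proof (rule LIMSEQ_le)
  show "(\<lambda>m. cmod (g n z - g m z)) \<longlonglongrightarrow> cmod (g n z - f z)"
    by (intro tendsto_intros gS z)
  show "(\<lambda>m. norm (S n - S m)) \<longlonglongrightarrow> norm (S n - T)"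
    by (intro tendsto_intros gS)
  show "\<exists>N. \<forall>m\<ge>N. cmod (g n z - g m z) \<le> norm (S n - S m)"
    using laurent_le_norm[OF laurent_minus[OF gS(1) gS(1)] z] by blast
qed

lemma has_symbol_norm_le:
  assumes "has_symbol T f" "\<And>z. z \<in> sphere 0 1 \<Longrightarrow> cmod (f z) \<le> B"
  shows "norm T \<le> B"
proof -
  obtain g S where gS: "\<And>n. laurent (g n) (S n)" "S \<longlonglongrightarrow> T" "\<And>z. z \<in> sphere 0 1 \<Longrightarrow> (\<lambda>n. g n z) \<longlonglongrightarrow> f z"
    using assms(1) unfolding has_symbol_def by blast
  have "norm (S n) \<le> B + norm (S n - T)" for n
  proof (rule laurent_norm_le[OF gS(1)])
    fix z :: complex assume z: "z \<in> sphere 0 1"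
    have "cmod (g n z) \<le> cmod (f z) + cmod (g n z - f z)"
      by (metis add.commute diff_add_cancel norm_triangle_ineq)
    then show "cmod (g n z) \<le> B + norm (S n - T)"
      using has_symbol_approx[OF gS z, of n] assms(2)[OF z] by linarith
  qed
  moreover have "(\<lambda>n. B + norm (S n - T)) \<longlonglongrightarrow> B + norm (T - T)"
    by (intro tendsto_intros gS)
  ultimately have "norm T \<le> B + norm (T - T)"
    by (intro LIMSEQ_le[OF tendsto_norm[OF gS(2)]]) blast+
  then show ?thesis by simp
qed

lemma has_symbol_continuous:
  assumes "has_symbol T f"
  shows "f \<in> C_circle"
proof -
  obtain g S where gS: "\<And>n. laurent (g n) (S n)" "S \<longlonglongrightarrow> T" "\<And>z. z \<in> sphere 0 1 \<Longrightarrow> (\<lambda>n. g n z) \<longlonglongrightarrow> f z"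
    using assms unfolding has_symbol_def by blast
  have "uniform_limit (sphere 0 1) g f sequentially"
  proof (rule uniform_limitI)
    fix e :: real assume "0 < e"
    then have "\<forall>\<^sub>F n in sequentially. norm (S n - T) < e"
      using tendstoD[OF gS(2)] by (simp add: dist_norm)
    then show "\<forall>\<^sub>F n in sequentially. \<forall>z\<in>sphere 0 1. dist (g n z) (f z) < e"
    proof (rule eventually_mono)
      fix n assume "norm (S n - T) < e"
      then show "\<forall>z\<in>sphere 0 1. dist (g n z) (f z) < e"
        unfolding dist_norm by (intro ballI le_less_trans[OF has_symbol_approx[OF gS]])
    qed
  qed
  then have "continuous_on (sphere 0 1) f"
    by (rule uniform_limit_theorem[rotated]) (simp_all add: laurent_continuous[OF gS(1)])
  then show ?thesis
    by (simp add: C_circle_def)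
qed

lemma has_symbol_bounded_ops:
  assumes "has_symbol T f"
  shows "T \<in> bounded_ops"
proof -
  obtain g S where gS: "\<And>n. laurent (g n) (S n)" "S \<longlonglongrightarrow> T"
    using assms unfolding has_symbol_def by blast
  show ?thesis
    by (rule closed_sequentially[OF closed_bounded_ops _ gS(2)]) (rule laurent_bounded_ops[OF gS(1)])
qed

lemma has_symbol_add: 
  assumes "has_symbol T f" "has_symbol T' f'"
  shows "has_symbol (T + T') (\<lambda>z. f z + f' z)"
proof -
  obtain g S where gS: "\<And>n. laurent (g n) (S n)" "S \<longlonglongrightarrow> T" "\<And>z. z \<in> sphere 0 1 \<Longrightarrow> (\<lambda>n. g n z) \<longlonglongrightarrow> f z"
    using assms(1) unfolding has_symbol_def by blast
  obtain g' S' where gS': "\<And>n. laurent (g' n) (S' n)" "S' \<longlonglongrightarrow> T'" "\<And>z. z \<in> sphere 0 1 \<Longrightarrow> (\<lambda>n. g' n z) \<longlonglongrightarrow> f' z"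
    using assms(2) unfolding has_symbol_def by blast
  show ?thesis
    unfolding has_symbol_def
    by (intro exI[of _ "\<lambda>n z. g n z + g' n z"] exI[of _ "\<lambda>n. S n + S' n"] conjI allI ballI
        laurent.add gS gS' tendsto_intros)
qed

lemma has_symbol_mult: 
  assumes "has_symbol T f" "has_symbol T' f'"
  shows "has_symbol (T o\<^sub>L T') (\<lambda>z. f z * f' z)"
proof -
  obtain g S where gS: "\<And>n. laurent (g n) (S n)" "S \<longlonglongrightarrow> T" "\<And>z. z \<in> sphere 0 1 \<Longrightarrow> (\<lambda>n. g n z) \<longlonglongrightarrow> f z"
    using assms(1) unfolding has_symbol_def by blast
  obtain g' S' where gS': "\<And>n. laurent (g' n) (S' n)" "S' \<longlonglongrightarrow> T'" "\<And>z. z \<in> sphere 0 1 \<Longrightarrow> (\<lambda>n. g' n z) \<longlonglongrightarrow> f' z"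
    using assms(2) unfolding has_symbol_def by blast
  have "(\<lambda>n. S n o\<^sub>L S' n) \<longlonglongrightarrow> (T o\<^sub>L T')"
    by (rule bounded_bilinear.tendsto[OF bounded_bilinear_blinfun_compose gS(2) gS'(2)])
  then show ?thesis
    unfolding has_symbol_def
    by (intro exI[of _ "\<lambda>n z. g n z * g' n z"] exI[of _ "\<lambda>n. S n o\<^sub>L S' n"] conjI allI ballI
        laurent_mult gS gS' tendsto_mult)
qed

lemma cmul_op_conv: "cmul_op c T = cmul_op c id_blinfun o\<^sub>L T"
  by (rule blinfun_eqI) simp

lemma has_symbol_const: "has_symbol (cmul_op c id_blinfun) (\<lambda>z. c)"
proof -
  have "shift_op 0 = id_blinfun"
    by (rule blinfun_eqI) (simp add: ell2_eq_iff)
  then show ?thesis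
    using laurent_has_symbol[OF laurent_const[of c]] by simp
qed

lemma has_symbol_cmul: "has_symbol T f \<Longrightarrow> has_symbol (cmul_op c T) (\<lambda>z. c * f z)"
  unfolding cmul_op_conv[of c T] by (intro has_symbol_mult has_symbol_const)

lemma has_symbol_minus:
  assumes "has_symbol T f" "has_symbol T' f'"
  shows "has_symbol (T - T') (\<lambda>z. f z - f' z)"
proof -
  have "T + cmul_op (- 1) T' = T - T'"
    by (rule blinfun_eqI) (simp add: blinfun.add_left blinfun.diff_left ell2_eq_iff)
  with has_symbol_add[OF assms(1) has_symbol_cmul[OF assms(2), of "- 1"]] show ?thesis
    by simp
qed

lemma has_symbol_cong: "has_symbol T f \<Longrightarrow> (\<And>z. z \<in> sphere 0 1 \<Longrightarrow> f z = g z) \<Longrightarrow> has_symbol T g"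
  unfolding has_symbol_def by simp

lemma has_symbol_unique:
  assumes "has_symbol T f" "has_symbol T' g" "\<And>z. z \<in> sphere 0 1 \<Longrightarrow> f z = g z"
  shows "T = T'"
  using has_symbol_norm_le[OF has_symbol_minus[OF assms(1,2)], of 0] assms(3) by simp

lemma has_symbol_eq:
  assumes "has_symbol T f" "has_symbol T g" "z \<in> sphere 0 1"
  shows "f z = g z"
  using has_symbol_le_norm[OF has_symbol_minus[OF assms(1,2)] assms(3)] by simp

lemma has_symbol_complete:
  assumes gS: "\<And>n. laurent (g n) (S n)" and u: "uniform_limit (sphere 0 1) g f sequentially"
  shows "\<exists>T. S \<longlonglongrightarrow> T \<and> has_symbol T f"
proof -
  have "Cauchy S"
  proof (rule CauchyI)
    fix e :: real assume e: "0 < e"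
    then obtain N where N: "\<And>n z. n \<ge> N \<Longrightarrow> z \<in> sphere 0 1 \<Longrightarrow> dist (g n z) (f z) < e / 3"
      using uniform_limitD[OF u, of "e / 3"] unfolding eventually_sequentially by force
    have "norm (S m - S n) < e" if "m \<ge> N" "n \<ge> N" for m n
    proof -
      have "norm (S m - S n) \<le> e / 3 + e / 3"
      proof (rule laurent_norm_le[OF laurent_minus[OF gS gS]])
        fix z :: complex assume z: "z \<in> sphere 0 1"
        show "cmod (g m z - g n z) \<le> e / 3 + e / 3"
          using N[OF that(1) z] N[OF that(2) z] dist_triangle_less_add[of "g m z" "f z" "e / 3" "g n z" "e / 3"]
          by (simp add: dist_norm norm_minus_commute)
      qed
      with e show ?thesis by simp
    qed
    then show "\<exists>M. \<forall>m\<ge>M. \<forall>n\<ge>M. norm (S m - S n) < e" by blast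
  qed
  then obtain T where "S \<longlonglongrightarrow> T"
    by (auto simp: Cauchy_convergent_iff convergent_def)
  with gS tendsto_uniform_limitI[OF u] show ?thesis
    unfolding has_symbol_def by blast
qed

lemma has_symbol_exists:
  assumes "f \<in> C_circle"
  shows "\<exists>T. has_symbol T f"
proof -
  have "\<exists>g. polynomial_function g \<and> (\<forall>z\<in>sphere 0 1. cmod (f z - g z) < inverse (Suc n))" for n
    using Stone_Weierstrass_polynomial_function[of "sphere 0 1" f "inverse (Suc n)"] assms
    by (simp add: C_circle_def)
  then have "\<exists>g S. laurent g S \<and> (\<forall>z\<in>sphere 0 1. cmod (f z - g z) < inverse (Suc n))" for n
    using laurent_polynomial by metis
  then obtain g S where gS: "\<And>n. laurent (g n) (S n)"
    and g: "\<And>n z. z \<in> sphere 0 1 \<Longrightarrow> cmod (f z - g n z) < inverse (Suc n)"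
    by metis
  have "uniform_limit (sphere 0 1) g f sequentially"
  proof (rule uniform_limitI)
    fix e :: real assume "0 < e"
    with LIMSEQ_inverse_real_of_nat have "\<forall>\<^sub>F n in sequentially. inverse (Suc n) < e"
      by (rule order_tendstoD)
    then show "\<forall>\<^sub>F n in sequentially. \<forall>z\<in>sphere 0 1. dist (g n z) (f z) < e"
    proof (rule eventually_mono)
      fix n assume "inverse (Suc n) < e"
      then show "\<forall>z\<in>sphere 0 1. dist (g n z) (f z) < e"
        unfolding dist_norm norm_minus_commute[of "g n _"] by (intro ballI less_trans[OF g])
    qed
  qed
  from has_symbol_complete[OF gS this] show ?thesis by blast
qed

lemma tendsto_blinfun_apply: "S \<longlonglongrightarrow> (T :: rop) \<Longrightarrow> (\<lambda>n. S n x) \<longlonglongrightarrow> T x"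
  by (intro tendsto_intros)

lemma has_symbol_cnj:
  assumes "has_symbol T f"
  shows "\<exists>T'. has_symbol T' (\<lambda>z. cnj (f z)) \<and> is_adjoint T' T"
proof -
  obtain g S where gS: "\<And>n. laurent (g n) (S n)" "S \<longlonglongrightarrow> T" "\<And>z. z \<in> sphere 0 1 \<Longrightarrow> (\<lambda>n. g n z) \<longlonglongrightarrow> f z"
    using assms unfolding has_symbol_def by blast
  obtain S' where S': "\<And>n. laurent (\<lambda>z. cnj (g n z)) (S' n)" "\<And>n. is_adjoint (S' n) (S n)"
    using laurent_cnj[OF gS(1)] by metis
  have "uniform_limit (sphere 0 1) (\<lambda>n z. cnj (g n z)) (\<lambda>z. cnj (f z)) sequentially"
  proof (rule uniform_limitI)
    fix e :: real assume "0 < e"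
    then have "\<forall>\<^sub>F n in sequentially. norm (S n - T) < e"
      using tendstoD[OF gS(2)] by (simp add: dist_norm)
    then show "\<forall>\<^sub>F n in sequentially. \<forall>z\<in>sphere 0 1. dist (cnj (g n z)) (cnj (f z)) < e"
    proof (rule eventually_mono)
      fix n assume "norm (S n - T) < e"
      then show "\<forall>z\<in>sphere 0 1. dist (cnj (g n z)) (cnj (f z)) < e"
        unfolding dist_norm complex_cnj_diff[symmetric] complex_mod_cnj
        by (intro ballI le_less_trans[OF has_symbol_approx[OF gS]])
    qed
  qed
  from has_symbol_complete[OF S'(1) this]
  obtain T' where T': "S' \<longlonglongrightarrow> T'" "has_symbol T' (\<lambda>z. cnj (f z))" by blast
  have "cinner (T' x) y = cinner x (T y)" for x y
  proof (rule LIMSEQ_unique)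
    show "(\<lambda>n. cinner (S' n x) y) \<longlonglongrightarrow> cinner (T' x) y"
      by (intro tendsto_cinner tendsto_blinfun_apply T' tendsto_const)
    have "cinner (S' n x) y = cinner x (S n y)" for n
      using S'(2)[of n] by (simp add: is_adjoint_def)
    then show "(\<lambda>n. cinner (S' n x) y) \<longlonglongrightarrow> cinner x (T y)"
      by (simp only:) (intro tendsto_cinner tendsto_blinfun_apply gS(2) tendsto_const)
  qed
  with T'(2) show ?thesis
    by (auto simp: is_adjoint_def)
qed

lemma closed_symbols: "closed {T. \<exists>f. has_symbol T f}"
proof -
  have "T \<in> {T. \<exists>f. has_symbol T f}"
    if X: "\<forall>n. X n \<in> {T. \<exists>f. has_symbol T f}" and lim: "X \<longlonglongrightarrow> T" for X T
  proof -
    have "\<forall>n. \<exists>f. has_symbol (X n) f" using X by simp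
    have "\<exists>g S. laurent g S \<and> norm (S - X n) < inverse (Suc n)" for n
    proof -
      obtain g S where gS: "\<And>n. laurent (g n) (S n)" "S \<longlonglongrightarrow> X n"
        using \<open>\<forall>n. \<exists>f. has_symbol (X n) f\<close>[rule_format, of n] unfolding has_symbol_def by blast
      have "\<forall>\<^sub>F k in sequentially. dist (S k) (X n) < inverse (Suc n)"
        by (rule tendstoD[OF gS(2)]) simp
      then obtain k where "dist (S k) (X n) < inverse (Suc n)"
        using eventually_happens'[OF sequentially_bot] by blast
      then have "norm (S k - X n) < inverse (Suc n)"
        by (simp only: dist_norm)
      with gS(1)[of k] show ?thesis by blast
    qed
    then obtain g S where gS: "\<And>n. laurent (g n) (S n)" "\<And>n. norm (S n - X n) < inverse (Suc n)"
      by metis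
    have "(\<lambda>n. S n - X n) \<longlonglongrightarrow> 0"
      by (rule Lim_null_comparison[OF _ LIMSEQ_inverse_real_of_nat])
        (intro always_eventually allI less_imp_le gS(2))
    from tendsto_add[OF this lim] have S: "S \<longlonglongrightarrow> T" by simp
    have "(\<lambda>n. g n z) \<longlonglongrightarrow> lim (\<lambda>n. g n z)" if z: "z \<in> sphere 0 1" for z
    proof -
      have "Cauchy (\<lambda>n. g n z)"
      proof (rule CauchyI)
        fix e :: real assume "0 < e"
        with LIMSEQ_imp_Cauchy[OF S] obtain M where M: "\<And>m n. m \<ge> M \<Longrightarrow> n \<ge> M \<Longrightarrow> norm (S m - S n) < e"
          by (meson CauchyD)
        have "cmod (g m z - g n z) < e" if "m \<ge> M" "n \<ge> M" for m n
          using laurent_le_norm[OF laurent_minus[OF gS(1) gS(1)] z, of m n] M[OF that] by linarith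
        then show "\<exists>M. \<forall>m\<ge>M. \<forall>n\<ge>M. norm (g m z - g n z) < e" by blast
      qed
      then show ?thesis
        using Cauchy_convergent convergent_LIMSEQ_iff by blast
    qed
    then have "has_symbol T (\<lambda>z. lim (\<lambda>n. g n z))"
      unfolding has_symbol_def by (intro exI[of _ g] exI[of _ S] conjI allI ballI gS S)
    then show ?thesis by (intro CollectI exI)
  qed
  then show ?thesis
    unfolding closed_sequential_limits by (intro allI impI, elim conjE) assumption
qed

lemma cstar_subalgebra_symbols: "cstar_subalgebra {T. \<exists>f. has_symbol T f}"
proof -
  have adj: "\<exists>g. has_symbol S g" if T: "has_symbol T f" and S: "is_adjoint S T" for S T f
  proof -
    obtain T' where "has_symbol T' (\<lambda>z. cnj (f z))" "is_adjoint T' T"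
      using has_symbol_cnj[OF T] by blast
    moreover have "S = T'"
      using is_adjoint_unique[OF S] \<open>is_adjoint T' T\<close> .
    ultimately show ?thesis by blast
  qed
  have "cmul_op 0 id_blinfun = 0"
    by (rule blinfun_eqI) (simp add: ell2_eq_iff)
  then have zero: "has_symbol 0 (\<lambda>z. 0)"
    using has_symbol_const[of 0] by simp
  show ?thesis
    unfolding cstar_subalgebra_def
  proof (intro conjI ballI allI impI closed_symbols subsetI)
    fix S T c assume "S \<in> {T. \<exists>f. has_symbol T f}" "T \<in> {T. \<exists>f. has_symbol T f}"
    then obtain f g where fg: "has_symbol S f" "has_symbol T g" by blast
    show "S + T \<in> {T. \<exists>f. has_symbol T f}" "S o\<^sub>L T \<in> {T. \<exists>f. has_symbol T f}"
      using has_symbol_add[OF fg] has_symbol_mult[OF fg] by blast+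
  next
    fix c T assume "T \<in> {T. \<exists>f. has_symbol T f}"
    then show "cmul_op c T \<in> {T. \<exists>f. has_symbol T f}"
      using has_symbol_cmul by blast
  qed (use zero adj has_symbol_bounded_ops in blast)+
qed

lemma has_symbol_ident: "has_symbol bilateral_shift (\<lambda>z. z)"
  using laurent_has_symbol[OF laurent.powi[of 1]] by simp

lemma Cstar_shift_eq: "Cstar_shift = {T. \<exists>f. has_symbol T f}"
proof
  show "Cstar_shift \<subseteq> {T. \<exists>f. has_symbol T f}"
    unfolding Cstar_shift_def
    by (rule hull_minimal[where S = cstar_subalgebra, OF _ cstar_subalgebra_symbols]) (use has_symbol_ident in auto)
  show "{T. \<exists>f. has_symbol T f} \<subseteq> Cstar_shift"
    unfolding Cstar_shift_def hull_def
  proof clarsimp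
    fix T f A assume T: "has_symbol T f" and A: "cstar_subalgebra A" "bilateral_shift \<in> A"
    obtain g S where gS: "\<And>n. laurent (g n) (S n)" "S \<longlonglongrightarrow> T"
      using T by (metis has_symbolE)
    have "closed A"
      using A by (simp add: cstar_subalgebra_def)
    then show "T \<in> A"
      by (rule closed_sequentially) (use cstar_subalgebra_laurent[OF A gS(1)] gS(2) in auto)
  qed
qed

theorem circle_star_iso_exists: "\<exists>\<Phi>. circle_star_iso \<Phi>"
proof -
  define \<Phi> where "\<Phi> f = (SOME T. has_symbol T f)" for f
  have \<Phi>: "has_symbol (\<Phi> f) f" if "f \<in> C_circle" for f
    unfolding \<Phi>_def by (rule someI_ex[OF has_symbol_exists[OF that]])
  have eqI: "\<Phi> f = T" if "has_symbol T f" for f T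
    by (rule has_symbol_unique[OF \<Phi>[OF has_symbol_continuous[OF that]] that]) simp
  have "circle_star_iso \<Phi>"
    unfolding circle_star_iso_def
  proof (intro conjI ballI allI)
    fix f g assume f: "f \<in> C_circle" and g: "g \<in> C_circle"
    show "\<Phi> f = \<Phi> g \<longleftrightarrow> (\<forall>z\<in>sphere 0 1. f z = g z)"
      using has_symbol_unique[OF \<Phi>[OF f] \<Phi>[OF g]] has_symbol_eq[OF \<Phi>[OF f]] \<Phi>[OF g] by metis
    show "\<Phi> (\<lambda>z. f z + g z) = \<Phi> f + \<Phi> g"
      by (intro eqI has_symbol_add \<Phi> f g)
    show "\<Phi> (\<lambda>z. f z * g z) = \<Phi> f o\<^sub>L \<Phi> g"
      by (intro eqI has_symbol_mult \<Phi> f g)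
    show "\<Phi> (\<lambda>z. c * f z) = cmul_op c (\<Phi> f)" for c
      by (intro eqI has_symbol_cmul \<Phi> f)
    show "is_adjoint (\<Phi> (\<lambda>z. cnj (f z))) (\<Phi> f)"
      using has_symbol_cnj[OF \<Phi>[OF f]] eqI by metis
  next
    show "\<Phi> ` C_circle = Cstar_shift"
      unfolding Cstar_shift_eq
    proof (intro equalityI subsetI)
      fix T assume "T \<in> {T. \<exists>f. has_symbol T f}"
      then obtain f where f: "has_symbol T f" by blast
      show "T \<in> \<Phi> ` C_circle"
        by (rule image_eqI[where x = f]) (simp_all only: eqI[OF f] has_symbol_continuous[OF f])
    qed (use \<Phi> in blast)
    show "\<Phi> (\<lambda>z. z) = bilateral_shift"
      by (intro eqI has_symbol_ident)
  qed
  then show ?thesis by blast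
qed

lemma circle_star_iso_symbol:
  assumes "circle_star_iso \<Phi>" "f \<in> C_circle"
  shows "has_symbol (\<Phi> f) f"
proof -
  note iso = assms(1)[unfolded circle_star_iso_def]
  have eq: "\<Phi> f = \<Phi> g" if "f \<in> C_circle" "g \<in> C_circle" "\<And>z. z \<in> sphere 0 1 \<Longrightarrow> f z = g z" for f g
    using iso[THEN conjunct1] that by blast
  have iadd: "\<Phi> (\<lambda>z. f z + g z) = \<Phi> f + \<Phi> g" if "f \<in> C_circle" "g \<in> C_circle" for f g
    using iso that by blast
  have imult: "\<Phi> (\<lambda>z. f z * g z) = \<Phi> f o\<^sub>L \<Phi> g" if "f \<in> C_circle" "g \<in> C_circle" for f g
    using iso that by blast
  have icmul: "\<Phi> (\<lambda>z. c * f z) = cmul_op c (\<Phi> f)" if "f \<in> C_circle" for f c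
    using iso that by blast
  have adj: "is_adjoint (\<Phi> (\<lambda>z. cnj (f z))) (\<Phi> f)" if "f \<in> C_circle" for f
    using iso that by blast
  have U: "\<Phi> (\<lambda>z. z) = bilateral_shift"
    using iso by blast
  have powC: "(\<lambda>z. z powi n) \<in> C_circle" for n
    using laurent_continuous[OF laurent.powi] by (simp add: C_circle_def)
  have constC: "(\<lambda>z. c) \<in> C_circle" for c
    by (simp add: C_circle_def)
  have shift_add: "shift_op m o\<^sub>L shift_op n = shift_op (m + n)" for m n
    by (rule blinfun_eqI) (simp add: ell2_eq_iff algebra_simps)
  have shift0: "shift_op 0 = id_blinfun"
    by (rule blinfun_eqI) (simp add: ell2_eq_iff)
  have one: "\<Phi> (\<lambda>z. 1) = id_blinfun"
  proof -
    have "\<Phi> (\<lambda>z. 1) o\<^sub>L bilateral_shift = bilateral_shift"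
      using imult[OF constC[of 1] powC[of 1]] U by simp
    then have Ufix: "\<Phi> (\<lambda>z. 1) (bilateral_shift y) = bilateral_shift y" for y
      using blinfun_apply_blinfun_compose[of "\<Phi> (\<lambda>z. 1)" bilateral_shift y] by simp
    show ?thesis
    proof (rule blinfun_eqI)
      fix x
      have "bilateral_shift (shift_op (- 1) x) = x"
        by (simp add: ell2_eq_iff)
      with Ufix[of "shift_op (- 1) x"] show "\<Phi> (\<lambda>z. 1) x = id_blinfun x"
        by simp
    qed
  qed
  have contr: "norm (\<Phi> h) \<le> B" if h: "h \<in> C_circle" and hB: "\<And>z. z \<in> sphere 0 1 \<Longrightarrow> cmod (h z) \<le> B" for h B
  proof -
    have B: "0 \<le> B"
      using order_trans[OF norm_ge_zero hB[of 1]] by simp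
    define k where "k z = complex_of_real (sqrt (B\<^sup>2 - (cmod (h z))\<^sup>2))" for z
    have k: "k \<in> C_circle" and hc: "(\<lambda>z. cnj (h z)) \<in> C_circle"
      using h unfolding C_circle_def k_def by (auto intro!: continuous_intros)
    then have hh: "(\<lambda>z. cnj (h z) * h z) \<in> C_circle" and kk: "(\<lambda>z. k z * k z) \<in> C_circle"
      using h unfolding C_circle_def by (auto intro!: continuous_intros)
    have "cnj (k z) = k z" for z
      by (simp add: k_def)
    then have "\<Phi> (\<lambda>z. cnj (k z)) = \<Phi> k"
      by simp
    with adj[OF k] have adk: "is_adjoint (\<Phi> k) (\<Phi> k)" by simp
    have "cnj (h z) * h z + k z * k z = of_real (B\<^sup>2) * 1" if "z \<in> sphere 0 1" for z
    proof -
      have "0 \<le> B\<^sup>2 - (cmod (h z))\<^sup>2"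
        using power_mono[OF hB[OF that], of 2] by simp
      then have 1: "k z * k z = of_real (B\<^sup>2 - (cmod (h z))\<^sup>2)"
        unfolding k_def of_real_mult[symmetric] by simp
      have 2: "cnj (h z) * h z = of_real ((cmod (h z))\<^sup>2)"
        unfolding complex_norm_square by (rule mult.commute)
      show ?thesis
        unfolding 1 2 by simp
    qed
    then have "\<Phi> (\<lambda>z. cnj (h z) * h z + k z * k z) = \<Phi> (\<lambda>z. of_real (B\<^sup>2) * 1)"
      using hh kk constC by (intro eq) (auto simp: C_circle_def intro: continuous_intros)
    then have sum: "(\<Phi> (\<lambda>z. cnj (h z)) o\<^sub>L \<Phi> h) + (\<Phi> k o\<^sub>L \<Phi> k) = cmul_op (of_real (B\<^sup>2)) id_blinfun"
      unfolding iadd[OF hh kk] imult[OF hc h] imult[OF k k] icmul[OF constC[of 1]] one .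
    show ?thesis
    proof (rule norm_blinfun_bound[OF B])
      fix x
      have "cinner x (((\<Phi> (\<lambda>z. cnj (h z)) o\<^sub>L \<Phi> h) + (\<Phi> k o\<^sub>L \<Phi> k)) x)
          = cinner (\<Phi> h x) (\<Phi> h x) + cinner (\<Phi> k x) (\<Phi> k x)"
        using is_adjoint_sym[OF adj[OF h]] adk
        by (simp add: is_adjoint_def blinfun.add_left cinner_add_right)
      then have "of_real (B\<^sup>2) * cinner x x = cinner (\<Phi> h x) (\<Phi> h x) + cinner (\<Phi> k x) (\<Phi> k x)"
        unfolding sum by (simp only: cmul_op_apply cinner_cscale_right blinfun_apply_id_blinfun id_apply)
      then have "complex_of_real (B\<^sup>2 * (norm x)\<^sup>2) = of_real ((norm (\<Phi> h x))\<^sup>2 + (norm (\<Phi> k x))\<^sup>2)"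
        unfolding cinner_self by (simp only: of_real_mult of_real_add)
      then have "B\<^sup>2 * (norm x)\<^sup>2 = (norm (\<Phi> h x))\<^sup>2 + (norm (\<Phi> k x))\<^sup>2"
        unfolding of_real_eq_iff .
      then have "(norm (\<Phi> h x))\<^sup>2 \<le> (B * norm x)\<^sup>2"
        by (simp add: power_mult_distrib)
      then show "norm (\<Phi> h x) \<le> B * norm x"
        by (rule power2_le_imp_le) (use B in simp)
    qed
  qed
  have shift: "\<Phi> (\<lambda>z. z powi n) = shift_op n" for n
  proof -
    have m1: "\<Phi> (\<lambda>z. z powi (- 1)) = shift_op (- 1)"
    proof -
      have "\<Phi> (\<lambda>z. cnj z) = \<Phi> (\<lambda>z. z powi (- 1))"
        using powC[of "- 1"] by (intro eq) (auto simp: C_circle_def power_int_minus circle_inverse intro: continuous_intros)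
      moreover have "is_adjoint (\<Phi> (\<lambda>z. cnj z)) bilateral_shift"
        using adj[OF powC[of 1]] U by simp
      ultimately show ?thesis
        using is_adjoint_unique is_adjoint_shift[of 1] by metis
    qed
    have step: "\<Phi> (\<lambda>z. z powi (n + m)) = shift_op (n + m)"
      if "\<Phi> (\<lambda>z. z powi n) = shift_op n" "\<Phi> (\<lambda>z. z powi m) = shift_op m" for n m
    proof -
      have mC: "(\<lambda>z. z powi n * z powi m) \<in> C_circle"
        using powC[of n] powC[of m] by (auto simp: C_circle_def intro: continuous_intros)
      have "\<Phi> (\<lambda>z. z powi (n + m)) = \<Phi> (\<lambda>z. z powi n * z powi m)"
        by (intro eq powC mC power_int_add) auto
      also have "\<dots> = shift_op (n + m)"
        by (simp add: imult[OF powC powC] that shift_add)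
      finally show ?thesis .
    qed
    show ?thesis
    proof (induction n rule: int_induct[where k = 0])
      case base
      then show ?case by (simp add: one shift0)
    next
      case (step1 i)
      then show ?case using step[OF _ , of i 1] U by simp
    next
      case (step2 i)
      then show ?case using step[OF _ m1, of i] by simp
    qed
  qed
  have laur: "\<Phi> g = S" if "laurent g S" for g S
    using that
  proof (induction)
    case (powi n)
    show ?case by (rule shift)
  next
    case (add f S g T)
    have "f \<in> C_circle" "g \<in> C_circle"
      using add.hyps laurent_continuous by (auto simp: C_circle_def)
    then show ?case
      by (simp add: iadd add.IH)
  next
    case (cmul f S c)
    have "f \<in> C_circle"
      using laurent_continuous[OF cmul.hyps] by (simp add: C_circle_def)
    then show ?case
      by (simp add: icmul cmul.IH)
  next
    case (cong f S g)
    have "laurent g S"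
      by (rule laurent.cong[OF cong.hyps(1)]) (rule cong.hyps(2))
    then have "f \<in> C_circle" "g \<in> C_circle"
      using laurent_continuous cong.hyps(1) by (auto simp: C_circle_def)
    from eq[OF this] cong.hyps(2) have "\<Phi> f = \<Phi> g" by blast
    with cong.IH show ?case by simp
  qed
  obtain T where T: "has_symbol T f"
    using has_symbol_exists[OF assms(2)] by blast
  obtain g S where gS: "\<And>n. laurent (g n) (S n)" "S \<longlonglongrightarrow> T" "\<And>z. z \<in> sphere 0 1 \<Longrightarrow> (\<lambda>n. g n z) \<longlonglongrightarrow> f z"
    using T unfolding has_symbol_def by blast
  have "norm (S n - \<Phi> f) \<le> norm (S n - T)" for n
  proof -
    have gC: "g n \<in> C_circle"
      using laurent_continuous[OF gS(1)] by (simp add: C_circle_def)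
    have mfC: "(\<lambda>z. (- 1) * f z) \<in> C_circle" and dC: "(\<lambda>z. g n z + (- 1) * f z) \<in> C_circle"
      using gC assms(2) by (auto simp: C_circle_def intro: continuous_intros)
    have "cmul_op (- 1) (\<Phi> f) = - \<Phi> f"
      by (rule blinfun_eqI) (simp add: blinfun.minus_left ell2_eq_iff)
    then have "\<Phi> (\<lambda>z. g n z + (- 1) * f z) = S n - \<Phi> f"
      using iadd[OF gC mfC] icmul[OF assms(2), of "- 1"] laur[OF gS(1)] by simp
    moreover have "norm (\<Phi> (\<lambda>z. g n z + (- 1) * f z)) \<le> norm (S n - T)"
      by (rule contr[OF dC]) (use has_symbol_approx[OF gS] in simp)
    ultimately show ?thesis by simp
  qed
  moreover have "(\<lambda>n. norm (S n - T)) \<longlonglongrightarrow> 0"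
    using gS(2) by (simp add: LIM_zero_iff tendsto_norm_zero_iff)
  ultimately have "(\<lambda>n. S n - \<Phi> f) \<longlonglongrightarrow> 0"
    by (intro Lim_null_comparison[of "\<lambda>n. S n - \<Phi> f"]) auto
  then have "S \<longlonglongrightarrow> \<Phi> f"
    by (simp add: LIM_zero_iff)
  then have "T = \<Phi> f"
    by (rule LIMSEQ_unique[OF gS(2)])
  with T show ?thesis by simp
qed

corollary circle_star_iso_unique:
  "circle_star_iso \<Phi> \<Longrightarrow> circle_star_iso \<Psi> \<Longrightarrow> f \<in> C_circle \<Longrightarrow> \<Phi> f = \<Psi> f"
  using circle_star_iso_symbol has_symbol_unique by metis

corollary circle_op_iso: "circle_star_iso circle_op"
  unfolding circle_op_def by (rule someI_ex[OF circle_star_iso_exists])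

end

theory Submission
  imports Defs
begin

text \<open>
  The derivation \<open>d1\<close> generates the rotation action.  Let \<open>V t\<close> be the diagonal unitary
  \<open>e\<^sub>j \<mapsto> cis (j t) e\<^sub>j\<close>.  Conjugation by \<open>V t\<close> multiplies the matrix entry at \<open>(j, k)\<close> by
  \<open>cis ((j - k) t)\<close>, whose derivative at \<open>t = 0\<close> is the factor \<open>\<i> (j - k)\<close> in the definition of \<open>d1\<close>;
  and it turns the operator with symbol \<open>f\<close> into the operator whose symbol is the rotated function
  \<open>z \<mapsto> f (cis t * z)\<close>, because this is so for the shift.  As the norm of an operator with a symbol is
  the supremum norm of that symbol, a function \<open>f\<close> is Lipschitz with constant \<open>B\<close> for the arc length
  if and only if \<open>\<parallel>V t T V (- t) - T\<parallel> \<le> B \<bar>t\<bar>\<close> for all \<open>t\<close>, where \<open>T\<close> is the operator of \<open>f\<close>.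

  It remains to compare this estimate with the bound \<open>\<parallel>d1 T\<parallel> \<le> B\<close>.  If \<open>d1 T\<close> is bounded, then every
  matrix coefficient of \<open>V t T V (- t)\<close> between finitely supported vectors is a trigonometric polynomial
  in \<open>t\<close> whose derivative is the same coefficient of \<open>V t (d1 T) V (- t)\<close>, and the mean value inequality
  gives the estimate (\<open>norm_conj_rot_diff_le\<close>).  Conversely, the difference quotients
  \<open>(V h T V (- h) - T) / h\<close> are bounded by \<open>B\<close> in norm and their entries converge as \<open>h \<longlongrightarrow> 0\<close>, so that they
  have a weak limit of norm at most \<open>B\<close> (\<open>bounded_ops_weak_limit\<close>), and this limit is \<open>d1 T\<close>.
  Both implications keep the constant, hence the norm of \<open>d1 T\<close> is the least Lipschitz constant.
\<close>

section \<open>Operators and their matrices\<close>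

lemma bounded_linear_coord: "bounded_linear (\<lambda>x. coord x j)"
  by (rule bounded_linear_intro[where K = 1]) (simp_all add: cmod_coord_le scaleR_conv_of_real)

lemma cmod_cinner_le: "cmod (cinner x y) \<le> norm x * norm y"
proof -
  \<comment> \<open>A unimodular factor makes the inner product real, which reduces the bound to the
    Cauchy-Schwarz inequality of the underlying real inner product space.\<close>
  define c where "c = cnj (sgn (cinner x y))"
  have "cinner x y * cnj (cinner x y) = of_real ((cmod (cinner x y))\<^sup>2)"
    by (rule complex_norm_square[symmetric])
  then have "c * cinner x y = of_real (cmod (cinner x y))"
    by (cases "cinner x y = 0")
      (simp_all add: c_def sgn_div_norm scaleR_conv_of_real field_simps power2_eq_square)
  then have "cmod (cinner x y) = Re (cinner x (cscale c y))"
    by (simp add: cinner_cscale_right)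
  also have "\<dots> \<le> norm x * norm (cscale c y)"
    unfolding inner_ell2_def[symmetric] by (rule norm_cauchy_schwarz)
  also have "\<dots> \<le> norm x * norm y"
    by (intro mult_left_mono) (simp_all add: c_def norm_sgn)
  finally show ?thesis .
qed

lemma cinner_fin_supp:
  assumes "fin_supp x"
  shows "cinner x y = (\<Sum>j | coord x j \<noteq> 0. cnj (coord x j) * coord y j)"
proof -
  have "cinner x y = (\<Sum>\<^sub>\<infinity>j\<in>{j. coord x j \<noteq> 0}. cnj (coord x j) * coord y j)"
    unfolding cinner_def by (rule infsum_cong_neutral) auto
  then show ?thesis
    using assms by (simp add: fin_supp_def)
qed

lemma coord_apply_has_sum:
  assumes "A \<in> bounded_ops"
  shows "((\<lambda>k. coord x k * entry A j k) has_sum coord (A x) j) UNIV"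
proof -
  have "bounded_linear (\<lambda>y. coord (A y) j)"
    by (rule bounded_linear_compose[OF bounded_linear_coord blinfun.bounded_linear_right])
  from has_sum_bounded_linear[OF this ebasis_has_sum[of x]] show ?thesis
    by (simp add: bounded_ops_D[OF assms] entry_def cinner_ebasis_left)
qed

lemma coord_apply_fin_supp:
  assumes "A \<in> bounded_ops" "fin_supp x"
  shows "coord (A x) j = (\<Sum>k | coord x k \<noteq> 0. coord x k * entry A j k)"
proof -
  have "((\<lambda>k. coord x k * entry A j k) has_sum (\<Sum>k | coord x k \<noteq> 0. coord x k * entry A j k))
      {k. coord x k \<noteq> 0}"
    using assms(2) by (intro has_sum_finite) (simp add: fin_supp_def)
  then have "((\<lambda>k. coord x k * entry A j k) has_sum (\<Sum>k | coord x k \<noteq> 0. coord x k * entry A j k)) UNIV"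
    by (rule has_sum_cong_neutral[THEN iffD1, rotated -1]) auto
  then show ?thesis
    by (rule has_sum_unique[OF coord_apply_has_sum[OF assms(1)]])
qed

lemma fin_supp_dense: "closure {x. fin_supp x} = UNIV"
proof -
  have "x \<in> closure {x. fin_supp x}" for x
    by (rule Lim_in_closed_set[OF closed_closure _ _ ebasis_has_sum[unfolded has_sum_def]])
      (auto intro!: eventually_finite_subsets_at_top_weakI closure_subset[THEN subsetD] fin_supp_partial)
  then show ?thesis by blast
qed

lemma blinfun_norm_le_fin_supp:
  fixes A :: rop
  assumes B: "0 \<le> B"
    and le: "\<And>x y. fin_supp x \<Longrightarrow> fin_supp y \<Longrightarrow> cmod (cinner x (A y)) \<le> B * norm x * norm y"
  shows "norm A \<le> B"
proof (rule norm_blinfun_bound[OF B])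
  have cc: "continuous_on UNIV (\<lambda>x. cinner x w)" for w
    unfolding continuous_on_def by (intro ballI tendsto_cinner tendsto_ident_at tendsto_const)
  have fin: "norm (A y) \<le> B * norm y" if y: "fin_supp y" for y
  proof -
    have "closure {x. fin_supp x} \<subseteq> {x. cmod (cinner x (A y)) \<le> B * norm x * norm y}"
      by (rule closure_minimal) (use le y in \<open>auto intro!: closed_Collect_le continuous_intros cc\<close>)
    then have "cmod (cinner (A y) (A y)) \<le> B * norm (A y) * norm y"
      unfolding fin_supp_dense by blast
    then have "norm (A y) * norm (A y) \<le> norm (A y) * (B * norm y)"
      unfolding cinner_self norm_of_real by (simp add: power2_eq_square mult_ac)
    then show ?thesis
      using B by (cases "A y = 0") simp_all
  qed
  have "closure {x. fin_supp x} \<subseteq> {x. norm (A x) \<le> B * norm x}"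
    by (rule closure_minimal) (use fin in \<open>auto intro!: closed_Collect_le continuous_intros\<close>)
  then show "norm (A x) \<le> B * norm x" for x
    unfolding fin_supp_dense by blast
qed

text \<open>
  Since the operators are uniformly bounded, convergence of the coordinates of \<open>D n x\<close> passes from
  finitely supported \<open>x\<close>, where it involves only finitely many entries, to all \<open>x\<close>.  The limit
  vector is square-summable with the same norm bound because each of its finite partial sums obeys it.
\<close>

lemma bounded_ops_weak_limit:
  assumes D: "\<And>n. D n \<in> bounded_ops" and le: "\<And>n. norm (D n) \<le> B"
    and lim: "\<And>j k. (\<lambda>n. entry (D n) j k) \<longlonglongrightarrow> M j k"
  shows "\<exists>S\<in>bounded_ops. norm S \<le> B \<and> (\<forall>j k. entry S j k = M j k)"
proof -
  have B: "0 \<le> B"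
    by (rule order_trans[OF norm_ge_zero le])
  have Dle: "norm (D n x) \<le> B * norm x" for n x
    by (rule order_trans[OF norm_blinfun mult_right_mono[OF le norm_ge_zero]])
  define l where "l x j = lim (\<lambda>n. coord (D n x) j)" for x j
  have l: "(\<lambda>n. coord (D n x) j) \<longlonglongrightarrow> l x j" for x j
  proof -
    have "Cauchy (\<lambda>n. coord (D n x) j)"
    proof (rule CauchyI)
      fix e :: real assume e: "0 < e"
      define d where "d = e / (3 * (B + 1))"
      have d: "0 < d" "B * d \<le> e / 3"
        using e B by (auto simp: d_def field_simps)
      obtain y where y: "fin_supp y" "dist y x < d"
        using fin_supp_dense d(1) closure_approachable[of x "{x. fin_supp x}"] by auto
      have "(\<lambda>n. coord (D n y) j) \<longlonglongrightarrow> (\<Sum>k | coord y k \<noteq> 0. coord y k * M j k)"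
        unfolding coord_apply_fin_supp[OF D y(1)] by (intro tendsto_intros lim)
      then obtain N where N: "\<And>m n. m \<ge> N \<Longrightarrow> n \<ge> N \<Longrightarrow> cmod (coord (D m y) j - coord (D n y) j) < e / 3"
        using CauchyD[OF LIMSEQ_imp_Cauchy, of _ _ "e / 3"] e by fastforce
      have close: "cmod (coord (D n x) j - coord (D n y) j) \<le> e / 3" for n
      proof -
        have "cmod (coord (D n x) j - coord (D n y) j) \<le> norm (D n (x - y))"
          using cmod_coord_le[of "D n (x - y)" j] by (simp add: blinfun.diff_right)
        also have "\<dots> \<le> B * norm (x - y)"
          by (rule Dle)
        also have "\<dots> \<le> B * d"
          using y(2) B by (intro mult_left_mono) (simp_all add: dist_norm norm_minus_commute)
        finally show ?thesis using d(2) by simp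
      qed
      have "cmod (coord (D m x) j - coord (D n x) j) < e" if "m \<ge> N" "n \<ge> N" for m n
        using close[of m] close[of n] N[OF that]
          norm_triangle_ineq[of "coord (D m x) j - coord (D m y) j" "coord (D m y) j - coord (D n x) j"]
          norm_triangle_ineq[of "coord (D m y) j - coord (D n y) j" "coord (D n y) j - coord (D n x) j"]
          norm_minus_commute[of "coord (D n y) j" "coord (D n x) j"]
        by simp
      then show "\<exists>N. \<forall>m\<ge>N. \<forall>n\<ge>N. cmod (coord (D m x) j - coord (D n x) j) < e" by blast
    qed
    then show ?thesis
      unfolding l_def using Cauchy_convergent convergent_LIMSEQ_iff by blast
  qed
  have fin: "(\<Sum>j\<in>F. (cmod (l x j))\<^sup>2) \<le> (B * norm x)\<^sup>2" if "finite F" for F x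
  proof (rule LIMSEQ_le_const2)
    show "(\<lambda>n. \<Sum>j\<in>F. (cmod (coord (D n x) j))\<^sup>2) \<longlonglongrightarrow> (\<Sum>j\<in>F. (cmod (l x j))\<^sup>2)"
      by (intro tendsto_intros l)
    have "(\<Sum>j\<in>F. (cmod (coord (D n x) j))\<^sup>2) \<le> (norm (D n x))\<^sup>2" for n
      by (rule finite_sum_le_has_sum[OF norm_ell2_has_sum]) (auto simp: that)
    then have "(\<Sum>j\<in>F. (cmod (coord (D n x) j))\<^sup>2) \<le> (B * norm x)\<^sup>2" for n
      by (rule order_trans) (intro power_mono Dle norm_ge_zero)
    then show "\<exists>N. \<forall>n\<ge>N. (\<Sum>j\<in>F. (cmod (coord (D n x) j))\<^sup>2) \<le> (B * norm x)\<^sup>2" by blast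
  qed
  define s where "s x = Abs_ell2 (l x)" for x
  have s: "coord (s x) j = l x j" for x j
  proof -
    have "(\<lambda>j. (cmod (l x j))\<^sup>2) summable_on UNIV"
    proof (rule nonneg_bdd_above_summable_on)
      show "bdd_above (sum (\<lambda>j. (cmod (l x j))\<^sup>2) ` {F. F \<subseteq> UNIV \<and> finite F})"
        by (rule bdd_aboveI2[where M = "(B * norm x)\<^sup>2"]) (use fin in blast)
    qed simp
    then show ?thesis
      by (simp add: s_def Abs_ell2_inverse)
  qed
  have s_le: "norm (s x) \<le> B * norm x" for x
  proof (rule power2_le_imp_le)
    show "(norm (s x))\<^sup>2 \<le> (B * norm x)\<^sup>2"
      by (rule has_sum_le_finite_sums[OF norm_ell2_has_sum]) (simp add: s fin)
  qed (use B in simp)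
  have s_add: "s (x + y) = s x + s y" for x y
  proof (rule ell2_eqI)
    fix j
    have "(\<lambda>n. coord (D n (x + y)) j) \<longlonglongrightarrow> l x j + l y j"
      using tendsto_add[OF l l] by (simp add: blinfun.add_right)
    then show "coord (s (x + y)) j = coord (s x + s y) j"
      using LIMSEQ_unique[OF l] by (simp add: s)
  qed
  have s_cscale: "s (cscale c x) = cscale c (s x)" for c x
  proof (rule ell2_eqI)
    fix j
    have "(\<lambda>n. coord (D n (cscale c x)) j) \<longlonglongrightarrow> c * l x j"
      using tendsto_mult_left[OF l] by (simp add: bounded_ops_D[OF D])
    then show "coord (s (cscale c x)) j = coord (cscale c (s x)) j"
      using LIMSEQ_unique[OF l] by (simp add: s)
  qed
  have "bounded_linear s"
    by (rule bounded_linear_intro[where K = B])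
      (simp_all add: s_add s_cscale s_le scaleR_ell2_def mult.commute)
  then have app: "Blinfun s x = s x" for x
    by (simp add: bounded_linear_Blinfun_apply)
  have "Blinfun s \<in> bounded_ops"
    by (simp add: bounded_ops_def app s_cscale)
  moreover have "norm (Blinfun s) \<le> B"
    by (rule norm_blinfun_bound[OF B]) (simp add: app s_le)
  moreover have "entry (Blinfun s) j k = M j k" for j k
    using LIMSEQ_unique[OF l[of "ebasis k" j]] lim[of j k] by (simp add: entry_def cinner_ebasis_left app s)
  ultimately show ?thesis by blast
qed

section \<open>The rotation action\<close>

lift_definition rot_ell2 :: "real \<Rightarrow> ell2 \<Rightarrow> ell2" is "\<lambda>t x j. cis (of_int j * t) * x j"
  by (simp add: norm_mult)

lemma coord_rot [simp]: "coord (rot_ell2 t x) j = cis (of_int j * t) * coord x j"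
  by (simp add: rot_ell2.rep_eq)

lemma norm_rot [simp]: "norm (rot_ell2 t x) = norm x"
proof -
  have "((\<lambda>j. (cmod (coord (rot_ell2 t x) j))\<^sup>2) has_sum (norm x)\<^sup>2) UNIV"
    using norm_ell2_has_sum[of x] by (simp add: norm_mult)
  then have "(norm (rot_ell2 t x))\<^sup>2 = (norm x)\<^sup>2"
    by (rule has_sum_unique[OF norm_ell2_has_sum])
  then show ?thesis
    by (rule power2_eq_imp_eq) simp_all
qed

definition rot_op :: "real \<Rightarrow> rop"
  where "rot_op t = Blinfun (rot_ell2 t)"

lemma rot_op_apply [simp]: "rot_op t x = rot_ell2 t x"
proof -
  have "bounded_linear (rot_ell2 t)"
    by (rule bounded_linear_intro[where K = 1]) (simp_all add: ell2_eq_iff algebra_simps)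
  then show ?thesis
    by (simp add: rot_op_def bounded_linear_Blinfun_apply)
qed

definition conj_rot :: "real \<Rightarrow> rop \<Rightarrow> rop"
  where "conj_rot t T = rot_op t o\<^sub>L T o\<^sub>L rot_op (- t)"

lemma conj_rot_apply [simp]: "conj_rot t T x = rot_ell2 t (T (rot_ell2 (- t) x))"
  by (simp add: conj_rot_def)

lemma bounded_ops_conj_rot: "T \<in> bounded_ops \<Longrightarrow> conj_rot t T \<in> bounded_ops"
proof -
  have "rot_op s \<in> bounded_ops" for s
    by (simp add: bounded_ops_def ell2_eq_iff mult.left_commute)
  then show "T \<in> bounded_ops \<Longrightarrow> conj_rot t T \<in> bounded_ops"
    unfolding conj_rot_def by (intro bounded_ops_comp)
qed

lemma norm_conj_rot_le: "norm (conj_rot t T) \<le> norm T"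
proof (rule norm_blinfun_bound)
  show "norm (conj_rot t T x) \<le> norm T * norm x" for x
    using norm_blinfun[of T "rot_ell2 (- t) x"] by simp
qed simp

lemma entry_conj_rot:
  assumes "T \<in> bounded_ops"
  shows "entry (conj_rot t T) j k = cis (of_int (j - k) * t) * entry T j k"
proof -
  have "rot_ell2 (- t) (ebasis k) = cscale (cis (- (of_int k * t))) (ebasis k)"
    by (simp add: ell2_eq_iff)
  then show ?thesis
    by (simp add: entry_def cinner_ebasis_left bounded_ops_D[OF assms] mult.assoc[symmetric] cis_mult
        left_diff_distrib)
qed

lemma laurent_conj_rot: "laurent f S \<Longrightarrow> laurent (\<lambda>z. f (cis t * z)) (conj_rot t S)"
proof (induction rule: laurent.induct)
  case (powi n)
  have "conj_rot t (shift_op n) = cmul_op (cis (of_int n * t)) (shift_op n)"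
  proof (rule blinfun_eqI, rule ell2_eqI)
    fix x j
    have "cis (of_int j * t) * cis (- (of_int (j - n) * t)) = cis (of_int n * t)"
      unfolding cis_mult by (simp add: algebra_simps)
    then show "coord (conj_rot t (shift_op n) x) j = coord (cmul_op (cis (of_int n * t)) (shift_op n) x) j"
      by (simp add: mult.assoc[symmetric])
  qed
  moreover have "cis (of_int n * t) * z powi n = (cis t * z) powi n" for z
    by (simp add: power_int_mult_distrib cis_power_int)
  ultimately show ?case
    using laurent.cmul[OF laurent.powi[of n], of "cis (of_int n * t)"] by simp
next
  case (add f S g T)
  have "conj_rot t (S + T) = conj_rot t S + conj_rot t T"
    by (rule blinfun_eqI) (simp add: blinfun.add_left ell2_eq_iff algebra_simps)
  then show ?case
    using laurent.add[OF add.IH] by simp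
next
  case (cmul f S c)
  have "conj_rot t (cmul_op c S) = cmul_op c (conj_rot t S)"
    by (rule blinfun_eqI) (simp add: ell2_eq_iff)
  then show ?case
    using laurent.cmul[OF cmul.IH, of c] by simp
next
  case (cong f S g)
  show ?case
    by (rule laurent.cong[OF cong.IH]) (use cong.hyps(2) in \<open>simp add: norm_mult\<close>)
qed

lemma has_symbol_conj_rot:
  assumes "has_symbol T f"
  shows "has_symbol (conj_rot t T) (\<lambda>z. f (cis t * z))"
proof -
  obtain g S where gS: "\<And>n. laurent (g n) (S n)" "S \<longlonglongrightarrow> T"
    "\<And>z. z \<in> sphere 0 1 \<Longrightarrow> (\<lambda>n. g n z) \<longlonglongrightarrow> f z"
    by (rule has_symbolE[OF assms]) blast
  have "(\<lambda>n. conj_rot t (S n)) \<longlonglongrightarrow> conj_rot t T"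
    unfolding conj_rot_def
    by (intro bounded_bilinear.tendsto[OF bounded_bilinear_blinfun_compose] tendsto_const gS(2))
  moreover have "(\<lambda>n. g n (cis t * z)) \<longlonglongrightarrow> f (cis t * z)" if "z \<in> sphere 0 1" for z
    by (rule gS(3)) (use that in \<open>simp add: norm_mult\<close>)
  ultimately show ?thesis
    unfolding has_symbol_def using laurent_conj_rot[OF gS(1)]
    by (intro exI[of _ "\<lambda>n z. g n (cis t * z)"] exI[of _ "\<lambda>n. conj_rot t (S n)"]) blast
qed

section \<open>The derivation as the generator of the rotation action\<close>

lemma has_vector_derivative_cis_mult:
  "((\<lambda>t. cis (a * t)) has_vector_derivative (\<i> * of_real a * cis (a * t))) (at t within A)"
proof -
  have "((\<lambda>w. exp (\<i> * of_real a * w)) has_field_derivative (\<i> * of_real a * exp (\<i> * of_real a * of_real t)))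
      (at (of_real t))"
    by (auto intro!: derivative_eq_intros)
  from has_vector_derivative_real_field[OF this] show ?thesis
    by (simp add: cis_conv_exp mult_ac)
qed

text \<open>
  The mean value inequality along the orbit \<open>t \<mapsto> conj_rot t T\<close>.  The orbit need not be differentiable in
  norm, so it is applied to single matrix coefficients between finitely supported vectors, which are
  trigonometric polynomials in \<open>t\<close>.
\<close>

lemma norm_conj_rot_diff_le:
  assumes T: "T \<in> bounded_ops" and S: "S \<in> bounded_ops"
    and ent: "\<And>j k. entry S j k = \<i> * of_int (j - k) * entry T j k"
  shows "norm (conj_rot t T - T) \<le> norm S * \<bar>t\<bar>"
proof (rule blinfun_norm_le_fin_supp)
  fix x y assume x: "fin_supp x" and y: "fin_supp y"
  let ?X = "{j. coord x j \<noteq> 0}" and ?Y = "{k. coord y k \<noteq> 0}"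
  have expand: "cinner x (A y) = (\<Sum>j\<in>?X. cnj (coord x j) * (\<Sum>k\<in>?Y. coord y k * entry A j k))"
    if "A \<in> bounded_ops" for A
    by (simp add: cinner_fin_supp[OF x] coord_apply_fin_supp[OF that y])
  define p where "p s = cinner x (conj_rot s T y)" for s
  have "(p has_vector_derivative cinner x (conj_rot s S y)) (at s within UNIV)" for s
  proof -
    have "((\<lambda>s. \<Sum>j\<in>?X. cnj (coord x j) * (\<Sum>k\<in>?Y. coord y k * (cis (of_int (j - k) * s) * entry T j k)))
        has_vector_derivative
        (\<Sum>j\<in>?X. cnj (coord x j) * (\<Sum>k\<in>?Y. coord y k * ((\<i> * of_real (of_int (j - k)) * cis (of_int (j - k) * s)) * entry T j k))))
        (at s within UNIV)"
      by (intro has_vector_derivative_sum has_vector_derivative_mult_right has_vector_derivative_mult_left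
          has_vector_derivative_cis_mult)
    moreover have "p = (\<lambda>s. \<Sum>j\<in>?X. cnj (coord x j) * (\<Sum>k\<in>?Y. coord y k * (cis (of_int (j - k) * s) * entry T j k)))"
      unfolding p_def expand[OF bounded_ops_conj_rot[OF T]] entry_conj_rot[OF T] ..
    moreover have "cinner x (conj_rot s S y) = (\<Sum>j\<in>?X. cnj (coord x j) *
        (\<Sum>k\<in>?Y. coord y k * ((\<i> * of_real (of_int (j - k)) * cis (of_int (j - k) * s)) * entry T j k)))"
      unfolding expand[OF bounded_ops_conj_rot[OF S]] entry_conj_rot[OF S] ent
      by (simp add: mult_ac)
    ultimately show ?thesis by simp
  qed
  moreover have "onorm (\<lambda>h. h *\<^sub>R cinner x (conj_rot s S y)) \<le> norm S * norm x * norm y" for s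
  proof (rule onorm_bound)
    fix h
    have "norm (conj_rot s S y) \<le> norm S * norm y"
      by (rule order_trans[OF norm_blinfun mult_right_mono[OF norm_conj_rot_le norm_ge_zero]])
    then have "norm x * norm (conj_rot s S y) \<le> norm x * (norm S * norm y)"
      by (rule mult_left_mono) simp
    with cmod_cinner_le[of x "conj_rot s S y"]
    have "cmod (cinner x (conj_rot s S y)) \<le> norm S * norm x * norm y"
      by (simp only: mult_ac)
    then show "norm (h *\<^sub>R cinner x (conj_rot s S y)) \<le> norm S * norm x * norm y * norm h"
      unfolding norm_scaleR real_norm_def mult.commute[of "\<bar>h\<bar>"] by (rule mult_right_mono) simp
  qed simp
  ultimately have "norm (p t - p 0) \<le> norm S * norm x * norm y * norm (t - 0)"
    by (intro differentiable_bound[where S = UNIV and f' = "\<lambda>s h. h *\<^sub>R cinner x (conj_rot s S y)"])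
      (simp_all add: has_vector_derivative_def)
  moreover have "p t = cinner x ((conj_rot t T - T) y) + p 0"
  proof -
    have "rot_ell2 0 w = w" for w
      by (simp add: ell2_eq_iff)
    then show ?thesis
      unfolding p_def cinner_add_right[symmetric] by (simp add: blinfun.diff_left)
  qed
  ultimately show "cmod (cinner x ((conj_rot t T - T) y)) \<le> norm S * \<bar>t\<bar> * norm x * norm y"
    by (simp add: mult_ac)
qed simp

section \<open>Lipschitz functions on the circle\<close>

text \<open>
  Each \<open>z\<close> is obtained from \<open>w\<close> by the rotation along the shorter arc, and the symbol of
  \<open>conj_rot t T - T\<close> at \<open>w\<close> is the increment of \<open>f\<close> along that arc.
\<close>

lemma symbol_Lipschitz:
  assumes f: "has_symbol T f" and S: "S \<in> bounded_ops"
    and ent: "\<And>j k. entry S j k = \<i> * of_int (j - k) * entry T j k"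
    and z: "z \<in> sphere 0 1" and w: "w \<in> sphere 0 1"
  shows "dist (f z) (f w) \<le> norm S * arc_dist z w"
proof -
  obtain t where t: "z = w * cis t" "\<bar>t\<bar> = arc_dist z w"
    using arc_dist_attained[OF z w] .
  have "cmod (f (cis t * w) - f w) \<le> norm (conj_rot t T - T)"
    by (rule has_symbol_le_norm[OF has_symbol_minus[OF has_symbol_conj_rot[OF f] f] w])
  also have "\<dots> \<le> norm S * \<bar>t\<bar>"
    by (rule norm_conj_rot_diff_le[OF has_symbol_bounded_ops[OF f] S ent])
  finally show ?thesis
    by (simp only: t dist_norm mult.commute)
qed

text \<open>
  The Lipschitz bound controls the symbols, hence the norms, of the difference quotients of the orbit
  \<open>t \<mapsto> conj_rot t T\<close> at \<open>0\<close>; the derivation is their weak limit.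
\<close>

lemma Lipschitz_symbol_derivation:
  assumes f: "has_symbol T f" and B: "0 \<le> B"
    and lip: "\<And>z w. z \<in> sphere 0 1 \<Longrightarrow> w \<in> sphere 0 1 \<Longrightarrow> dist (f z) (f w) \<le> B * arc_dist z w"
  shows "\<exists>S\<in>bounded_ops. norm S \<le> B \<and> (\<forall>j k. entry S j k = \<i> * of_int (j - k) * entry T j k)"
proof -
  note T = has_symbol_bounded_ops[OF f]
  define h where "h n = inverse (real (Suc n))" for n
  have h: "h n > 0" for n
    by (simp add: h_def)
  define D where "D n = cmul_op (of_real (inverse (h n))) (conj_rot (h n) T - T)" for n
  have sym: "has_symbol (D n) (\<lambda>z. of_real (inverse (h n)) * (f (cis (h n) * z) - f z))" for n
    unfolding D_def by (intro has_symbol_cmul has_symbol_minus has_symbol_conj_rot f)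
  have le: "norm (D n) \<le> B" for n
  proof (rule has_symbol_norm_le[OF sym])
    fix z :: complex assume z: "z \<in> sphere 0 1"
    have "dist (f (cis (h n) * z)) (f z) \<le> B * arc_dist (cis (h n) * z) z"
      using z by (intro lip) (simp_all add: norm_mult)
    also have "\<dots> \<le> B * h n"
      using arc_dist_le[OF z, of "cis (h n) * z" "h n"] h[of n] B by (intro mult_left_mono) (simp_all add: mult.commute)
    finally have "inverse (h n) * dist (f (cis (h n) * z)) (f z) \<le> inverse (h n) * (B * h n)"
      using h[of n] by (intro mult_left_mono) simp_all
    moreover have "inverse (h n) * (B * h n) = B"
      using h[of n] by simp
    ultimately show "cmod (of_real (inverse (h n)) * (f (cis (h n) * z) - f z)) \<le> B"
      unfolding norm_mult norm_of_real dist_norm using h[of n] by simp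
  qed
  have ent: "entry (D n) j k = (cis (of_int (j - k) * h n) - 1) / of_real (h n) * entry T j k" for n j k
    using entry_conj_rot[OF T, of "h n" j k]
    by (simp add: D_def entry_def cinner_ebasis_left blinfun.diff_left divide_inverse algebra_simps)
  have "(\<lambda>n. entry (D n) j k) \<longlonglongrightarrow> \<i> * of_int (j - k) * entry T j k" for j k
  proof -
    let ?a = "\<i> * complex_of_int (j - k)"
    have "((\<lambda>w. exp (?a * w)) has_field_derivative ?a) (at 0)"
      by (auto intro!: derivative_eq_intros)
    then have "((\<lambda>w. (exp (?a * w) - 1) / w) \<longlongrightarrow> ?a) (at 0)"
      by (simp add: has_field_derivative_iff)
    moreover have "filterlim (\<lambda>n. complex_of_real (h n)) (at 0) sequentially"
      unfolding filterlim_at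
    proof
      have "h \<longlonglongrightarrow> 0"
        unfolding h_def by (rule LIMSEQ_inverse_real_of_nat)
      then show "(\<lambda>n. complex_of_real (h n)) \<longlonglongrightarrow> 0"
        by (metis tendsto_of_real of_real_0)
      show "\<forall>\<^sub>F n in sequentially. complex_of_real (h n) \<in> UNIV \<and> complex_of_real (h n) \<noteq> 0"
        using h by (simp add: less_imp_neq[THEN not_sym])
    qed
    ultimately have "(\<lambda>n. (exp (?a * of_real (h n)) - 1) / of_real (h n)) \<longlonglongrightarrow> ?a"
      by (rule filterlim_compose)
    then have "(\<lambda>n. (cis (of_int (j - k) * h n) - 1) / of_real (h n)) \<longlonglongrightarrow> ?a"
      by (simp add: cis_conv_exp mult_ac)
    then show ?thesis
      unfolding ent by (rule tendsto_mult_right)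
  qed
  from bounded_ops_weak_limit[OF has_symbol_bounded_ops[OF sym] le this] show ?thesis .
qed

lemma arc_Lipschitz_continuous:
  assumes "\<And>z w. z \<in> sphere 0 1 \<Longrightarrow> w \<in> sphere 0 1 \<Longrightarrow> dist (f z) (f w) \<le> B * arc_dist z w"
  shows "f \<in> C_circle"
  unfolding C_circle_def continuous_on_def
proof (intro CollectI ballI)
  fix w :: complex assume w: "w \<in> sphere 0 1"
  then have [simp]: "w \<noteq> 0" by auto
  have "((\<lambda>z. Arg (z / w)) \<longlongrightarrow> Arg 1) (at w within sphere 0 1)"
  proof (rule isCont_tendsto_compose[OF continuous_at_Arg])
    have "((\<lambda>z. z / w) \<longlongrightarrow> w / w) (at w within sphere 0 1)"
      by (intro tendsto_intros) simp
    then show "((\<lambda>z. z / w) \<longlongrightarrow> 1) (at w within sphere 0 1)" by simp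
  qed simp
  then have "((\<lambda>z. B * \<bar>Arg (z / w)\<bar>) \<longlongrightarrow> B * \<bar>Arg 1\<bar>) (at w within sphere 0 1)"
    by (intro tendsto_mult_left tendsto_rabs)
  then have "((\<lambda>z. B * arc_dist z w) \<longlongrightarrow> 0) (at w within sphere 0 1)"
    by (simp add: arc_dist_def)
  then have "((\<lambda>z. f z - f w) \<longlongrightarrow> 0) (at w within sphere 0 1)"
    by (rule Lim_null_comparison[rotated])
      (use assms w in \<open>auto simp: eventually_at_filter dist_norm\<close>)
  then show "(f \<longlongrightarrow> f w) (at w within sphere 0 1)"
    by (simp add: LIM_zero_iff)
qed

theorem proposition4p5:
  shows "Lip1_circle = {f. Lipschitz_continuous_map arc_metric (euclidean_metric :: complex metric) f} \<and>
    (\<forall>f\<in>Lip1_circle. norm (d1_op (circle_op f)) =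
      Lipschitz_constant arc_metric (euclidean_metric :: complex metric) f)"
proof (intro conjI ballI)
  let ?lip = "\<lambda>f B. \<forall>z\<in>sphere 0 1. \<forall>w\<in>sphere 0 1. dist (f z) (f w) \<le> B * arc_dist z w"
  have sym: "has_symbol (circle_op f) f" if "f \<in> C_circle" for f
    by (rule circle_star_iso_symbol[OF circle_op_iso that])
  have Lip: "?lip f (norm (d1_op (circle_op f)))" if "f \<in> Lip1_circle" for f
    using that symbol_Lipschitz[OF sym Lip1_op_d1_op] by (simp add: Lip1_circle_def)
  have d1: "f \<in> Lip1_circle \<and> norm (d1_op (circle_op f)) \<le> B" if B: "0 \<le> B" "?lip f B" for f B
  proof -
    have f: "f \<in> C_circle"
      by (rule arc_Lipschitz_continuous[where B = B]) (use B in blast)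
    obtain S where S: "S \<in> bounded_ops" "norm S \<le> B"
      "\<And>j k. entry S j k = \<i> * of_int (j - k) * entry (circle_op f) j k"
      using Lipschitz_symbol_derivation[OF sym[OF f] B(1)] B(2) by blast
    have "f \<in> Lip1_circle"
      using f S has_symbol_bounded_ops[OF sym[OF f]] by (auto simp: Lip1_circle_def Lip1_op_def)
    with S d1_op_eqI[OF S(1,3)] show ?thesis by simp
  qed
  show "Lip1_circle = {f. Lipschitz_continuous_map arc_metric euclidean_metric f}"
  proof (intro equalityI subsetI CollectI)
    fix f assume "f \<in> Lip1_circle"
    then show "Lipschitz_continuous_map arc_metric euclidean_metric f"
      unfolding Lipschitz_continuous_map_def using Lip by auto
  next
    fix f :: "complex \<Rightarrow> complex"
    assume "f \<in> {f. Lipschitz_continuous_map arc_metric euclidean_metric f}"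
    then obtain B where "0 < B" "?lip f B"
      unfolding Lipschitz_continuous_map_pos by auto
    then show "f \<in> Lip1_circle"
      using d1[of B f] by simp
  qed
  fix f assume f: "f \<in> Lip1_circle"
  have "Inf {B. 0 \<le> B \<and> ?lip f B} = norm (d1_op (circle_op f))"
    by (rule cInf_eq_minimum) (use Lip[OF f] d1 in auto)
  then show "norm (d1_op (circle_op f)) = Lipschitz_constant arc_metric euclidean_metric f"
    by (simp add: Lipschitz_constant_def)
qed

end
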